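(* Let $Q$ be a Markov transition kernel on $(\mathsf X,\mathcal X)$, $g:\mathsf X\times\mathsf Y\to[0,\infty)$ the likelihood, and $\{Y_k\}_{k\ge0}$ a stochastic process on a measurable space $(\Omega,\mathcal A)$ with values in $(\mathsf Y,\mathcal Y)$ (not necessarily the observation process of a hidden Markov model). Let $\mathbb P_\star$ be a probability measure on $(\Omega,\mathcal A)$ with expectation $\mathbb E_\star$. Assume that there are a set $\mathsf K\subseteq\mathsf Y$ and a function $V:\mathsf X\to[1,\infty)$ such that for every $\eta>0$ there is an LD-set $\mathsf C\in\mathcal X$ with $\Upsilon_{\mathsf C^c}(y)\le\eta\,\Upsilon_{\mathsf X}(y)$ for all $y\in\mathsf K$. Let $\mathsf D$ be an LD-set. Then, for any $M_i>0$, $i=0,1,2$, and any $\gamma\in(0,1)$, there exists $\beta\in(0,1)$ such that, for all probability measures $\nu$ and $\nu'$ on $(\mathsf X,\mathcal X)$ and all $n$, $$\mathbb E_\star\left(\left\|\phi_{\nu,n}[Y_{0:n}]-\phi_{\nu',n}[Y_{0:n}]\right\|_{\mathrm{TV}}\right)\le\beta^n\left[1+\nu(V)\nu'(V)\right]+r_0(\nu,n)+r_0(\nu',n)+\sum_{i=1}^3r_i(n),$$ where $$r_0(\nu,n)=\mathbb P_\star\left(\log\Phi_{\nu,\mathsf D}(Y_0,Y_1)\le-M_0n\right),\qquad r_1(n)=\mathbb P_\star\left(\sum_{i=0}^n\log\Upsilon_{\mathsf X}(Y_i)\ge M_1n\right),$$ $$r_2(n)=\mathbb P_\star\left(\sum_{i=2}^n\log\Psi_{\mathsf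 D}(Y_i)\le-M_2n\right),\qquad r_3(n)=\mathbb P_\star\left(n^{-1}\sum_{i=1}^n\mathbf 1_{\mathsf K}(Y_i)\le(1+\gamma)/2\right).$$
   Context: $\mathsf X$ and $\mathsf Y$ are spaces equipped with countably generated $\sigma$-fields $\mathcal X$ and $\mathcal Y$. There are a transition kernel $G$ from $(\mathsf X,\mathcal X)$ to $(\mathsf Y,\mathcal Y)$ and a measure $\mu$ on $(\mathsf Y,\mathcal Y)$ such that $G(x,\cdot)$ is absolutely continuous with respect to $\mu$ for every $x$, and $g(x,\cdot)=dG(x,\cdot)/d\mu$ is the likelihood (jointly measurable). For non-negative measurable $f$, $Qf(x)=\int Q(x,dx')f(x')$, and $\nu(f)=\int f\,d\nu$. Functions such as $V$ are measurable. Filtering distribution: for a probability measure $\nu$ on $(\mathsf X,\mathcal X)$, $y_{0:n}=[y_0,\dots,y_n]\in\mathsf Y^{n+1}$ and $A\in\mathcal X$, $$\phi_{\nu,n}[y_{0:n}](A)=\frac{\int_{\mathsf X^{n+1}}\nu(dx_0)g(x_0,y_0)\prod_{i=1}^nQ(x_{i-1},dx_i)g(x_i,y_i)\,\mathbf 1_A(x_n)}{\int_{\mathsf X^{n+1}}\nu(dx_0)g(x_0,y_0)\prod_{i=1}^nQ(x_{i-1},dx_i)g(x_i,y_i)}.$$ If the denominator is $0$ or $+\infty$, $\phi_{\nu,n}[y_{0:n}]$ is understood to be some fixed probability measure. Total variation: $\|\phi-\phi'\|_{\mathrm{TV}}=\sup_{A\in\mathcal X}|\phi(A)-\phi'(A)|$,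 so it is at most $1$. Convention: $\log0=-\infty$. LD-set (local Doeblin set): $\mathsf C\in\mathcal X$ is an LD-set if there are a measure $\lambda_{\mathsf C}$ and constants $\epsilon^-_{\mathsf C}>0$, $\epsilon^+_{\mathsf C}>0$ with $\lambda_{\mathsf C}(\mathsf C)>0$ and, for all $A\in\mathcal X$ and $x\in\mathsf C$, $\epsilon^-_{\mathsf C}\lambda_{\mathsf C}(A\cap\mathsf C)\le Q(x,A\cap\mathsf C)\le\epsilon^+_{\mathsf C}\lambda_{\mathsf C}(A\cap\mathsf C)$. Each LD-set is considered together with such a choice of $\lambda_{\mathsf C},\epsilon^\pm_{\mathsf C}$. For $\mathsf A\in\mathcal X$, $\Upsilon_{\mathsf A}(y)=\sup_{x\in\mathsf A}g(x,y)\,QV(x)/V(x)$ (with $\sup\emptyset=0$). For an LD-set $\mathsf D$ and a probability measure $\nu$, $\Phi_{\nu,\mathsf D}(y_0,y_1)=\iint\nu(dx_0)g(x_0,y_0)Q(x_0,dx_1)g(x_1,y_1)\mathbf 1_{\mathsf D}(x_1)$ and $\Psi_{\mathsf D}(y)=\int_{\mathsf D}g(x,y)\lambda_{\mathsf D}(dx)$. *)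

theory Defs
  imports "HOL-Probability.Probability"
begin

definition countably_generated :: "'a measure \<Rightarrow> bool" where
  "countably_generated M \<longleftrightarrow>
     (\<exists>E. countable E \<and> E \<subseteq> Pow (space M) \<and> sets M = sigma_sets (space M) E)"

(* Not necessarily Markov: no normalisation is imposed.  Markov kernels are the elements of
   M \<rightarrow>\<^sub>M prob_algebra N. *)
definition transition_kernel :: "'a measure \<Rightarrow> 'b measure \<Rightarrow> ('a \<Rightarrow> 'b measure) \<Rightarrow> bool" where
  "transition_kernel M N G \<longleftrightarrow>
     (\<forall>x\<in>space M. sets (G x) = sets N) \<and>
     (\<forall>A\<in>sets N. (\<lambda>x. emeasure (G x) A) \<in> borel_measurable M)"

(* lam is a measure on all of the state space; only its restriction to C matters. *)
definition LD_with ::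
    "'x measure \<Rightarrow> ('x \<Rightarrow> 'x measure) \<Rightarrow> 'x set \<Rightarrow> 'x measure \<Rightarrow> real \<Rightarrow> real \<Rightarrow> bool" where
  "LD_with X Q C lam e_lo e_up \<longleftrightarrow>
     C \<in> sets X \<and> sets lam = sets X \<and> 0 < e_lo \<and> 0 < e_up \<and> 0 < emeasure lam C \<and>
     (\<forall>A\<in>sets X. \<forall>x\<in>C.
        ennreal e_lo * emeasure lam (A \<inter> C) \<le> emeasure (Q x) (A \<inter> C) \<and>
        emeasure (Q x) (A \<inter> C) \<le> ennreal e_up * emeasure lam (A \<inter> C))"

definition LD_set :: "'x measure \<Rightarrow> ('x \<Rightarrow> 'x measure) \<Rightarrow> 'x set \<Rightarrow> bool" where
  "LD_set X Q C \<longleftrightarrow> (\<exists>lam e_lo e_up. LD_with X Q C lam e_lo e_up)"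

(* path_int Q g nu y n f is the iterated integral
     \<integral> nu(dx_0) g(x_0,y_0) \<integral> Q(x_0,dx_1) g(x_1,y_1) ... \<integral> Q(x_(n-1),dx_n) g(x_n,y_n) f(x_n);
   the recursion peels off the innermost integral. *)
primrec path_int ::
    "('x \<Rightarrow> 'x measure) \<Rightarrow> ('x \<Rightarrow> 'y \<Rightarrow> real) \<Rightarrow> 'x measure \<Rightarrow> (nat \<Rightarrow> 'y) \<Rightarrow> nat
      \<Rightarrow> ('x \<Rightarrow> ennreal) \<Rightarrow> ennreal" where
  "path_int Q g nu y 0 f = (\<integral>\<^sup>+x. ennreal (g x (y 0)) * f x \<partial>nu)"
| "path_int Q g nu y (Suc n) f =
     path_int Q g nu y n (\<lambda>x. \<integral>\<^sup>+x'. ennreal (g x' (y (Suc n))) * f x' \<partial>Q x)"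

(* phi0 is the fixed probability measure used when the normalising constant is 0 or infinite.
   Only y 0, ..., y n matter.  That the set function below really is a measure, so that
   measure_of does not degenerate, is the content of emeasure_filt. *)
definition filt ::
    "'x measure \<Rightarrow> ('x \<Rightarrow> 'x measure) \<Rightarrow> ('x \<Rightarrow> 'y \<Rightarrow> real) \<Rightarrow> 'x measure
      \<Rightarrow> 'x measure \<Rightarrow> nat \<Rightarrow> (nat \<Rightarrow> 'y) \<Rightarrow> 'x measure" where
  "filt X Q g phi0 nu n y =
     (if path_int Q g nu y n (\<lambda>_. 1) \<in> {0, \<infinity>} then phi0
      else measure_of (space X) (sets X)
             (\<lambda>A. path_int Q g nu y n (indicator A) / path_int Q g nu y n (\<lambda>_. 1)))"

definition tv_dist :: "'a measure \<Rightarrow> 'a measure \<Rightarrow> real" where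
  "tv_dist M N = (SUP A\<in>sets M. \<bar>measure M A - measure N A\<bar>)"

definition Upsilon ::
    "('x \<Rightarrow> 'x measure) \<Rightarrow> ('x \<Rightarrow> 'y \<Rightarrow> real) \<Rightarrow> ('x \<Rightarrow> real) \<Rightarrow> 'x set \<Rightarrow> 'y \<Rightarrow> ennreal" where
  "Upsilon Q g V A y =
     (SUP x\<in>A. ennreal (g x y) * (\<integral>\<^sup>+x'. ennreal (V x') \<partial>Q x) / ennreal (V x))"

definition Phi ::
    "('x \<Rightarrow> 'x measure) \<Rightarrow> ('x \<Rightarrow> 'y \<Rightarrow> real) \<Rightarrow> 'x measure \<Rightarrow> 'x set \<Rightarrow> 'y \<Rightarrow> 'y \<Rightarrow> ennreal" where
  "Phi Q g nu D y0 y1 =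
     (\<integral>\<^sup>+x0. ennreal (g x0 y0) * (\<integral>\<^sup>+x1. ennreal (g x1 y1) * indicator D x1 \<partial>Q x0) \<partial>nu)"

definition Psi :: "('x \<Rightarrow> 'y \<Rightarrow> real) \<Rightarrow> 'x measure \<Rightarrow> 'x set \<Rightarrow> 'y \<Rightarrow> ennreal" where
  "Psi g lam D y = (\<integral>\<^sup>+x\<in>D. ennreal (g x y) \<partial>lam)"

(* Sums of values of elog follow the convention of ereal, \<infinity> + (-\<infinity>) = \<infinity>. *)
definition elog :: "ennreal \<Rightarrow> ereal" where
  "elog x = (if x = 0 then -\<infinity> else if x = \<infinity> then \<infinity> else ereal (ln (enn2real x)))"

(* Upsilon is a supremum over a possibly uncountable set and K is an arbitrary set of
   observations, so some of the events below need not be measurable, in which case emeasure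
   would return 0.  The outer probability coincides with emeasure on measurable events
   (event_prob_eq) and keeps the bound meaningful for the others. *)
definition event_prob :: "'w measure \<Rightarrow> ('w \<Rightarrow> bool) \<Rightarrow> ennreal" where
  "event_prob P R = outer_measure_of P {w \<in> space P. R w}"

lemma event_prob_eq:
  "{w \<in> space P. R w} \<in> sets P \<Longrightarrow> event_prob P R = emeasure P {w \<in> space P. R w}"
  by (simp add: event_prob_def)

context
  fixes X :: "'x measure" and Y :: "'y measure" and Q :: "'x \<Rightarrow> 'x measure"
    and g :: "'x \<Rightarrow> 'y \<Rightarrow> real" and nu :: "'x measure" and y :: "nat \<Rightarrow> 'y"
  assumes Q: "Q \<in> X \<rightarrow>\<^sub>M prob_algebra X"
    and g: "case_prod g \<in> borel_measurable (X \<Otimes>\<^sub>M Y)"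
    and nu: "sets nu = sets X"
    and y: "\<And>i. y i \<in> space Y"
begin

lemma measurable_g: "(\<lambda>x. g x (y i)) \<in> borel_measurable X"
  using measurable_compose[OF measurable_Pair2'[OF y[of i]] g] by simp

lemma measurable_step:
  assumes [measurable]: "f \<in> borel_measurable X"
  shows "(\<lambda>x. \<integral>\<^sup>+x'. ennreal (g x' (y i)) * f x' \<partial>Q x) \<in> borel_measurable X"
proof -
  note measurable_g[measurable]
  have Q': "Q \<in> X \<rightarrow>\<^sub>M subprob_algebra X"
    using Q by (rule measurable_prob_algebraD)
  show ?thesis
    by (rule measurable_compose[OF Q' nn_integral_measurable_subprob_algebra]) measurable
qed

lemma path_int_suminf:
  assumes "\<And>k. f k \<in> borel_measurable X"
  shows "path_int Q g nu y n (\<lambda>x. \<Sum>k::nat. f k x) = (\<Sum>k. path_int Q g nu y n (f k))"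
  using assms
proof (induction n arbitrary: f)
  case 0
  have "(\<lambda>x. ennreal (g x (y 0)) * f k x) \<in> borel_measurable nu" for k
    using measurable_g[of 0] 0[of k] unfolding measurable_cong_sets[OF nu refl] by measurable
  then show ?case
    by (simp add: nn_integral_suminf flip: ennreal_suminf_cmult)
next
  case (Suc n)
  have eq: "path_int Q g nu y n h = path_int Q g nu y n h'"
    if "\<And>x. x \<in> space X \<Longrightarrow> h x = h' x" for h h'
    using that
  proof (induction n arbitrary: h h')
    case 0
    then show ?case
      using sets_eq_imp_space_eq[OF nu] by (auto intro!: nn_integral_cong)
  next
    case (Suc m)
    have "space (Q x) = space X" if "x \<in> space X" for x
      using measurable_space[OF Q that] by (auto simp: space_prob_algebra dest: sets_eq_imp_space_eq)
    with Suc.prems show ?case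
      by (auto intro!: Suc.IH nn_integral_cong)
  qed
  have "(\<integral>\<^sup>+x'. ennreal (g x' (y (Suc n))) * (\<Sum>k. f k x') \<partial>Q x) =
        (\<Sum>k. \<integral>\<^sup>+x'. ennreal (g x' (y (Suc n))) * f k x' \<partial>Q x)" if "x \<in> space X" for x
  proof -
    have s: "sets (Q x) = sets X"
      using measurable_space[OF Q that] by (auto simp: space_prob_algebra)
    have "(\<lambda>x. ennreal (g x (y (Suc n))) * f k x) \<in> borel_measurable (Q x)" for k
      using measurable_g[of "Suc n"] Suc.prems[of k]
      unfolding measurable_cong_sets[OF s refl] by measurable
    then show ?thesis
      by (simp add: nn_integral_suminf flip: ennreal_suminf_cmult)
  qed
  then have "path_int Q g nu y (Suc n) (\<lambda>x. \<Sum>k. f k x) =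
      path_int Q g nu y n (\<lambda>x. \<Sum>k. \<integral>\<^sup>+x'. ennreal (g x' (y (Suc n))) * f k x' \<partial>Q x)"
    by (auto intro: eq)
  also have "\<dots> = (\<Sum>k. path_int Q g nu y (Suc n) (f k))"
    using Suc.prems by (simp add: Suc.IH measurable_step)
  finally show ?case .
qed

lemma path_int_zero: "path_int Q g nu y n (\<lambda>_. 0) = 0"
  by (induction n) simp_all

lemma emeasure_filt:
  assumes "path_int Q g nu y n (\<lambda>_. 1) \<noteq> 0" "path_int Q g nu y n (\<lambda>_. 1) \<noteq> \<infinity>"
    and A: "A \<in> sets X"
  shows "emeasure (filt X Q g phi0 nu n y) A =
    path_int Q g nu y n (indicator A) / path_int Q g nu y n (\<lambda>_. 1)"
proof -
  let ?m = "\<lambda>A. path_int Q g nu y n (indicator A) / path_int Q g nu y n (\<lambda>_. 1)"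
  have ca: "countably_additive (sets X) ?m"
  proof (rule countably_additiveI)
    fix F :: "nat \<Rightarrow> 'x set"
    assume F: "range F \<subseteq> sets X" "disjoint_family F"
    have "path_int Q g nu y n (indicator (\<Union>i. F i)) =
        path_int Q g nu y n (\<lambda>x. \<Sum>i. indicator (F i) x)"
      using F(2) by (intro arg_cong[where f="path_int Q g nu y n"] ext)
        (simp add: suminf_indicator)
    also have "\<dots> = (\<Sum>i. path_int Q g nu y n (indicator (F i)))"
      using F(1) by (intro path_int_suminf) auto
    finally show "(\<Sum>i. ?m (F i)) = ?m (\<Union> (range F))"
      by simp
  qed
  have "indicator {} = (\<lambda>_::'x. 0::ennreal)"
    by (simp add: fun_eq_iff)
  then have "positive (sets X) ?m"
    by (simp add: positive_def path_int_zero)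
  with ca A show ?thesis
    using assms(1,2) sets.sets_into_space[of _ X]
    by (subst emeasure_measure_of[where \<Omega>="space X" and A="sets X" and \<mu>="?m"])
       (auto simp: filt_def sets.sigma_sets_eq)
qed

end

end

theory Submission
  imports Defs
begin

text \<open>
  For indicator functions $f$ one has to bound
  $\phi_{\nu,n}(f) - \phi_{\nu',n}(f)$, whose numerator is an antisymmetric functional of two
  independent copies of the chain.  Each step of the pair inside $\mathsf C \times \mathsf C$
  contains a symmetric component, which cancels, so it costs a factor
  $\rho = 1 - (\epsilon^-/\epsilon^+)^2$.  Either the pair makes at least $s$ such steps, which
  gives $\rho^s$, or it is outside $\mathsf C \times \mathsf C$ often; then it is so at many times
  with $Y_i \in \mathsf K$, and each of these gains a factor $\eta = t^{-2}$ in the drift of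
  $V \otimes V$.  The alternative is propagated backwards in time with $s$ as a free parameter.
  The denominators are bounded below by forcing the chain to stay in $\mathsf D$, at exponential cost
  that a large $t$ compensates.
\<close>

text \<open>Uniformity in the initial laws and in n dictates the order of the choices. Off the
  exceptional events, the squared drift product divided by the squared lower bound of the
  denominators is at most E^n, with E depending only on the M_i and the lower Doeblin constant of D.
  Then t is fixed by t^(\<gamma>/2) = 2 E, next the LD-set C for 1/t^2, and last \<beta>. As t
  precedes C, it does not matter how close to 1 the rate \<rho> of C is; C and D need not be
  related.

  The threshold (1 + \<gamma>)/2 comes from an exponent count. Every observation outside K forfeits
  t^2, and off the event of r_3 there are at most (1 - \<gamma>) n / 2 of them among times 1 to n.
  This leaves \<gamma> n powers of 1/t: a quarter pays for t^s with s = floor(\<gamma> n / 4), a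
  quarter covers the uncounted time 0, and the remaining half beats E^n by a factor 2^(-n).

  Integrals may be infinite, so differences are avoided: the antisymmetric functional appears as a
  one-sided inequality \<open>F \<le> F' + R\<close>, applied in both directions once the
  denominators are known to be positive and finite.\<close>

section \<open>Comparison of measures\<close>

lemma nn_integral_mono_emeasure:
  assumes "sets N = sets M" "\<And>A. A \<in> sets M \<Longrightarrow> emeasure N A \<le> emeasure M A"
  shows "nn_integral N f \<le> nn_integral M f"
proof (rule nn_integral_mono_measure)
  have "emeasure N A \<le> emeasure M A" for A
    using assms by (cases "A \<in> sets M") (auto simp: emeasure_notin_sets)
  then show "N \<le> M"
    using assms(1) sets_eq_imp_space_eq[OF assms(1)] by (simp add: le_measure_iff le_fun_def)
qed fact

lemma nn_integral_emeasure_add: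
  assumes s: "sets N = sets M" "sets S = sets M"
    and add: "\<And>A. A \<in> sets M \<Longrightarrow> emeasure M A = emeasure N A + emeasure S A"
    and f: "f \<in> borel_measurable M"
  shows "nn_integral M f = nn_integral N f + nn_integral S f"
  using f
proof induction
  case (cong f g)
  have "space N = space M" "space S = space M"
    using s by (auto dest: sets_eq_imp_space_eq)
  with cong show ?case
    by (metis (no_types, lifting) nn_integral_cong)
next
  case (set A)
  with s show ?case
    by (simp add: add)
next
  case (mult u c)
  with s show ?case
    by (simp add: nn_integral_cmult distrib_left measurable_cong_sets[OF s(1) refl]
        measurable_cong_sets[OF s(2) refl])
next
  case (add u v)
  with s show ?case
    by (simp add: nn_integral_add ac_simps measurable_cong_sets[OF s(1) refl]
        measurable_cong_sets[OF s(2) refl])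
next
  case (seq U)
  from seq(1) have *: "U i \<in> borel_measurable N" "U i \<in> borel_measurable S" for i
    by (auto simp: measurable_cong_sets[OF s(1) refl] measurable_cong_sets[OF s(2) refl])
  have "(\<lambda>x. (SUP i. U i) x) = (\<lambda>x. SUP i. U i x)"
    by (simp add: fun_eq_iff image_comp)
  moreover have "(SUP i. nn_integral N (U i) + nn_integral S (U i)) =
      (SUP i. nn_integral N (U i)) + (SUP i. nn_integral S (U i))"
    using seq(3) by (intro ennreal_SUP_add) (auto intro!: incseq_nn_integral)
  ultimately show ?case
    using seq * by (simp add: nn_integral_monotone_convergence_SUP)
qed

text \<open>Split \<open>M\<close> into \<open>N\<close> and a rest \<open>S\<close>. The lower
  bound on \<open>N\<close> makes \<open>S\<close> at most \<open>1 - c\<close> times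
  \<open>M\<close>, and under \<open>N\<close> the two integrals agree, so
  \<open>F \<le> F' + R\<close> has to be integrated against \<open>S\<close> alone.\<close>

lemma nn_integral_le_contraction:
  fixes c :: real
  assumes fin: "finite_measure M" "finite_measure N" and s: "sets N = sets M"
    and c: "0 \<le> c" "c \<le> 1"
    and lo: "\<And>A. A \<in> sets M \<Longrightarrow> ennreal c * emeasure M A \<le> emeasure N A"
    and up: "\<And>A. A \<in> sets M \<Longrightarrow> emeasure N A \<le> emeasure M A"
    and m: "F \<in> borel_measurable M" "F' \<in> borel_measurable M" "R \<in> borel_measurable M"
    and le: "\<And>x. x \<in> space M \<Longrightarrow> F x \<le> F' x + R x"
    and eq: "nn_integral N F = nn_integral N F'"
  shows "nn_integral M F \<le> nn_integral M F' + (\<integral>\<^sup>+x. ennreal (1 - c) * R x \<partial>M)"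
proof -
  define S where "S = diff_measure M N"
  have sS: "sets S = sets M"
    by (simp add: S_def)
  have S: "emeasure S A = emeasure M A - emeasure N A" if "A \<in> sets M" for A
    unfolding S_def using fin s[symmetric] up that by (rule emeasure_diff_measure)
  interpret M: finite_measure M by fact
  interpret N: finite_measure N by fact
  have add: "emeasure M A = emeasure N A + emeasure S A" if "A \<in> sets M" for A
    using S[OF that] up[OF that] by (simp add: add_diff_inverse_ennreal)
  have split: "nn_integral M f = nn_integral N f + nn_integral S f" if "f \<in> borel_measurable M" for f
    using s sS add that by (rule nn_integral_emeasure_add)
  have S_le: "emeasure S A \<le> emeasure (scale_measure (ennreal (1 - c)) M) A" if "A \<in> sets M" for A
  proof -
    have "emeasure M A = ennreal (measure M A)" "emeasure N A = ennreal (measure N A)"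
      by (simp_all add: M.emeasure_eq_measure N.emeasure_eq_measure)
    with lo[OF that] S[OF that] c show ?thesis
      by (simp add: ennreal_minus ennreal_mult[symmetric] algebra_simps ennreal_leI)
  qed
  have [measurable]: "F \<in> borel_measurable S" "F' \<in> borel_measurable S" "R \<in> borel_measurable S"
    using m by (auto simp: measurable_cong_sets[OF sS refl])
  have "nn_integral M F = nn_integral N F' + nn_integral S F"
    using split[OF m(1)] eq by simp
  also have "nn_integral S F \<le> nn_integral S (\<lambda>x. F' x + R x)"
    using le sS by (intro nn_integral_mono) (auto dest: sets_eq_imp_space_eq)
  also have "\<dots> = nn_integral S F' + nn_integral S R"
    by (rule nn_integral_add) measurable
  also have "nn_integral S R \<le> nn_integral (scale_measure (ennreal (1 - c)) M) R"
    using sS S_le by (intro nn_integral_mono_emeasure) auto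
  also have "\<dots> = (\<integral>\<^sup>+x. ennreal (1 - c) * R x \<partial>M)"
    using m by (simp add: nn_integral_scale_measure nn_integral_cmult)
  finally show ?thesis
    using split[OF m(2)] by (simp add: ac_simps add_left_mono)
qed

lemma emeasure_pair_mono:
  assumes fin: "finite_measure M2" "finite_measure N2"
    and s: "sets N1 = sets M1" "sets N2 = sets M2"
    and le: "\<And>A. A \<in> sets M1 \<Longrightarrow> emeasure N1 A \<le> emeasure M1 A"
      "\<And>A. A \<in> sets M2 \<Longrightarrow> emeasure N2 A \<le> emeasure M2 A"
    and A: "A \<in> sets (M1 \<Otimes>\<^sub>M M2)"
  shows "emeasure (N1 \<Otimes>\<^sub>M N2) A \<le> emeasure (M1 \<Otimes>\<^sub>M M2) A"
proof -
  interpret M2: finite_measure M2 by fact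
  interpret N2: finite_measure N2 by fact
  have A': "A \<in> sets (N1 \<Otimes>\<^sub>M N2)"
    using A sets_pair_measure_cong[OF s] by simp
  have "emeasure (N1 \<Otimes>\<^sub>M N2) A = (\<integral>\<^sup>+x. emeasure N2 (Pair x -` A) \<partial>N1)"
    by (rule N2.emeasure_pair_measure_alt[OF A'])
  also have "\<dots> \<le> (\<integral>\<^sup>+x. emeasure M2 (Pair x -` A) \<partial>N1)"
    using le(2) sets_Pair1[OF A] by (intro nn_integral_mono) auto
  also have "\<dots> \<le> (\<integral>\<^sup>+x. emeasure M2 (Pair x -` A) \<partial>M1)"
    using s(1) le(1) by (rule nn_integral_mono_emeasure)
  finally show ?thesis
    by (simp add: M2.emeasure_pair_measure_alt[OF A])
qed

lemma finite_measure_scale_measure: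
  "finite_measure M \<Longrightarrow> r \<noteq> \<infinity> \<Longrightarrow> finite_measure (scale_measure r M)"
  by (intro finite_measureI)
     (auto simp: ennreal_mult_eq_top_iff finite_measure.emeasure_finite)

lemma emeasure_pair_scale_measure:
  assumes fin: "finite_measure M2" and r: "r \<noteq> \<infinity>"
    and A: "A \<in> sets (M1 \<Otimes>\<^sub>M M2)"
  shows "emeasure (scale_measure r M1 \<Otimes>\<^sub>M scale_measure r M2) A = r * r * emeasure (M1 \<Otimes>\<^sub>M M2) A"
proof -
  interpret M2: finite_measure M2 by fact
  interpret S: finite_measure "scale_measure r M2"
    using fin r by (rule finite_measure_scale_measure)
  have A': "A \<in> sets (scale_measure r M1 \<Otimes>\<^sub>M scale_measure r M2)"
    using A sets_pair_measure_cong[of "scale_measure r M1" M1 "scale_measure r M2" M2] by simp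
  have "(\<lambda>x. emeasure M2 (Pair x -` A)) \<in> borel_measurable M1"
    using A by (rule M2.measurable_emeasure_Pair)
  then show ?thesis
    by (simp add: S.emeasure_pair_measure_alt[OF A'] M2.emeasure_pair_measure_alt[OF A]
        nn_integral_scale_measure nn_integral_cmult mult.assoc)
qed

lemma nn_integral_pair_mult:
  assumes fin: "finite_measure N"
    and f: "f \<in> borel_measurable M" and h: "h \<in> borel_measurable N"
  shows "(\<integral>\<^sup>+z. f (fst z) * h (snd z) \<partial>(M \<Otimes>\<^sub>M N)) = (\<integral>\<^sup>+x. f x \<partial>M) * (\<integral>\<^sup>+x. h x \<partial>N)"
proof -
  interpret N: finite_measure N by fact
  note f[measurable] h[measurable]
  have "(\<lambda>z. f (fst z) * h (snd z)) \<in> borel_measurable (M \<Otimes>\<^sub>M N)"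
    by measurable
  from N.nn_integral_fst[OF this]
  have "(\<integral>\<^sup>+z. f (fst z) * h (snd z) \<partial>(M \<Otimes>\<^sub>M N)) = (\<integral>\<^sup>+x. \<integral>\<^sup>+y. f x * h y \<partial>N \<partial>M)"
    by simp
  then show ?thesis
    by (simp add: nn_integral_cmult nn_integral_multc)
qed

section \<open>Coupling of two chains on a local Doeblin set\<close>

text \<open>The mass of \<open>p\<close> is at most 1, so \<open>lam\<close> has finite mass on
  \<open>C\<close>, and this mass can be cancelled from the two bounds.\<close>

lemma doeblin_constants:
  fixes lo up :: real
  assumes "ennreal lo * emeasure lam C \<le> emeasure p C" "emeasure p C \<le> ennreal up * emeasure lam C"
    and "emeasure p C \<le> 1" "0 < emeasure lam C" "0 < lo" "0 < up"
  shows "emeasure lam C \<noteq> \<infinity>" "lo \<le> up"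
proof -
  have "ennreal lo * emeasure lam C \<le> 1"
    using assms(1,3) by (rule order_trans)
  then show fin: "emeasure lam C \<noteq> \<infinity>"
    using assms(5) by (auto simp: ennreal_mult_top top_unique)
  have "ennreal lo * emeasure lam C \<le> ennreal up * emeasure lam C"
    using assms(1,2) by (rule order_trans)
  with fin assms(4-6) show "lo \<le> up"
    by (cases "emeasure lam C") (auto simp: ennreal_mult[symmetric])
qed

text \<open>On \<open>C\<close> both laws dominate the same measure \<open>L\<close>, namely
  \<open>lo\<close> times \<open>lam\<close>, so their product dominates the symmetric measure
  \<open>N\<close>, which in turn is at least \<open>(lo / up)\<^sup>2\<close> times that product.
  Under \<open>N\<close> exchanging the coordinates changes nothing. Two remainders are needed
  because \<open>B0\<close> is multiplied by the contraction factor on \<open>C \<times> C\<close>,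
  whereas elsewhere \<open>B\<close> enters in full.\<close>

lemma doeblin_pair_contraction:
  fixes lo up :: real and B B0 :: "'x \<times> 'x \<Rightarrow> ennreal"
  assumes prob: "prob_space p" "prob_space p'"
    and s: "sets p = sets X" "sets p' = sets X" "sets lam = sets X"
    and C: "C \<in> sets X" "0 < emeasure lam C" and pos: "0 < lo" "0 < up"
    and le: "\<And>q A. q \<in> {p, p'} \<Longrightarrow> A \<in> sets X \<Longrightarrow> ennreal lo * emeasure lam (A \<inter> C) \<le> emeasure q (A \<inter> C)"
      "\<And>q A. q \<in> {p, p'} \<Longrightarrow> A \<in> sets X \<Longrightarrow> emeasure q (A \<inter> C) \<le> ennreal up * emeasure lam (A \<inter> C)"
    and f: "f \<in> borel_measurable X" and h: "h \<in> borel_measurable X"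
    and B0: "B0 \<in> borel_measurable (X \<Otimes>\<^sub>M X)" and B: "B \<in> borel_measurable (X \<Otimes>\<^sub>M X)"
    and inside: "\<And>u v. u \<in> C \<Longrightarrow> v \<in> C \<Longrightarrow> f u * h v \<le> h u * f v + B0 (u, v)"
      "\<And>u v. u \<in> C \<Longrightarrow> v \<in> C \<Longrightarrow> ennreal (1 - (lo / up)\<^sup>2) * B0 (u, v) \<le> B (u, v)"
    and outside: "\<And>u v. u \<in> space X \<Longrightarrow> v \<in> space X \<Longrightarrow> \<not> (u \<in> C \<and> v \<in> C) \<Longrightarrow>
      f u * h v \<le> h u * f v + B (u, v)"
  shows "(\<integral>\<^sup>+x. f x \<partial>p) * (\<integral>\<^sup>+x. h x \<partial>p') \<le>
    (\<integral>\<^sup>+x. h x \<partial>p) * (\<integral>\<^sup>+x. f x \<partial>p') + (\<integral>\<^sup>+z. B z \<partial>(p \<Otimes>\<^sub>M p'))"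
proof -
  interpret p: prob_space p by fact
  interpret p': prob_space p' by fact
  define pC where "pC q = density q (indicator C)" for q :: "'x measure"
  have sC: "sets (pC q) = sets q" "space (pC q) = space q" for q
    by (simp_all add: pC_def)
  have pC: "emeasure (pC q) A = emeasure q (A \<inter> C)" if "sets q = sets X" "A \<in> sets X" for q A
    using that C(1) by (simp add: pC_def emeasure_density Int_commute flip: nn_integral_restrict_space indicator_inter_arith)
  have XC: "space X \<inter> C = C" using C(1) sets.sets_into_space by auto
  have spX: "space p = space X" "space p' = space X" "space lam = space X"
    using s by (auto dest: sets_eq_imp_space_eq)
  have "ennreal lo * emeasure lam C \<le> emeasure p C" "emeasure p C \<le> ennreal up * emeasure lam C"
    using le[of p "space X"] XC by auto
  then have lam_fin: "emeasure lam C \<noteq> \<infinity>" and lo_up: "lo \<le> up"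
    using doeblin_constants C(2) pos p.emeasure_le_1 by blast+
  have finq: "finite_measure (pC q)" if "q \<in> {p, p'}" for q
    using that pC[of q "space X"] s sC[of q] spX
    by (intro finite_measureI) auto
  have finlam: "finite_measure (pC lam)"
    using pC[of lam "space X"] s sC[of lam] spX XC lam_fin
    by (intro finite_measureI) auto
  define c where "c = lo / up"
  have c: "0 < c" "c \<le> 1"
    using pos lo_up by (auto simp: c_def)
  define L where "L = scale_measure (ennreal lo) (pC lam)"
  have finL: "finite_measure L"
    unfolding L_def using finlam by (rule finite_measure_scale_measure) simp
  have L: "sets L = sets X" "emeasure L A = ennreal lo * emeasure lam (A \<inter> C)"
    if "A \<in> sets X" for A
    using that s spX by (simp_all add: L_def sC pC)
  have sL: "sets L = sets X" using L(1)[of "{}"] by simp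
  have L_up: "emeasure L A \<le> emeasure (pC q) A" if "A \<in> sets X" "q \<in> {p, p'}" for A q
    using that L(2) le(1) s by (auto simp: pC)
  have L_lo: "emeasure (scale_measure (ennreal c) (pC q)) A \<le> emeasure L A"
    if "A \<in> sets X" "q \<in> {p, p'}" for A q
  proof -
    have "emeasure (scale_measure (ennreal c) (pC q)) A = ennreal c * emeasure q (A \<inter> C)"
      using that s by (auto simp: pC)
    also have "\<dots> \<le> ennreal c * (ennreal up * emeasure lam (A \<inter> C))"
      using that le(2) by (intro mult_left_mono) auto
    also have "\<dots> = emeasure L A"
      using that L pos by (simp add: c_def mult.assoc[symmetric] ennreal_mult[symmetric])
    finally show ?thesis .
  qed
  define M where "M = pC p \<Otimes>\<^sub>M pC p'"
  define N where "N = L \<Otimes>\<^sub>M L"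
  have sM: "sets M = sets (X \<Otimes>\<^sub>M X)"
    unfolding M_def by (rule sets_pair_measure_cong) (simp_all add: sC s)
  have sN: "sets N = sets (X \<Otimes>\<^sub>M X)"
    unfolding N_def by (rule sets_pair_measure_cong) (simp_all add: sL)
  have sP: "sets (p \<Otimes>\<^sub>M p') = sets (X \<Otimes>\<^sub>M X)"
    by (rule sets_pair_measure_cong) (simp_all add: s)
  have spP: "space (p \<Otimes>\<^sub>M p') = space X \<times> space X"
    by (simp add: space_pair_measure spX)
  have fin: "finite_measure M" "finite_measure N"
    unfolding M_def N_def using finq finL by (auto intro: finite_measure_pair_measure)
  have up: "emeasure N A \<le> emeasure M A" if "A \<in> sets M" for A
    unfolding M_def N_def using that finq finL L_up
    by (intro emeasure_pair_mono) (auto simp: sL sC s M_def)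
  have lo: "ennreal (c\<^sup>2) * emeasure M A \<le> emeasure N A" if "A \<in> sets M" for A
  proof -
    have "ennreal (c\<^sup>2) * emeasure M A =
        emeasure (scale_measure (ennreal c) (pC p) \<Otimes>\<^sub>M scale_measure (ennreal c) (pC p')) A"
      using that finq c
      by (subst emeasure_pair_scale_measure) (auto simp: M_def power2_eq_square ennreal_mult)
    also have "\<dots> \<le> emeasure N A"
      unfolding N_def using that finq finL L_lo
      by (intro emeasure_pair_mono finite_measure_scale_measure)
         (auto simp: sL sC s M_def sM[unfolded M_def] sN[unfolded N_def])
    finally show ?thesis .
  qed
  \<comment> \<open>Cutting off to \<open>C\<close> makes the inequality known on
    \<open>C \<times> C\<close> hold on the whole space, as the comparison of \<open>M\<close> and
    \<open>N\<close> requires.\<close>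
  define fC where "fC u = indicator C u * f u" for u
  define hC where "hC u = indicator C u * h u" for u
  have mC: "fC \<in> borel_measurable X" "hC \<in> borel_measurable X"
    unfolding fC_def hC_def using f h C(1) by measurable
  define F where "F z = fC (fst z) * hC (snd z)" for z
  define F' where "F' z = hC (fst z) * fC (snd z)" for z
  define H where "H z = f (fst z) * h (snd z)" for z
  define H' where "H' z = h (fst z) * f (snd z)" for z
  have mF: "F \<in> borel_measurable (X \<Otimes>\<^sub>M X)" "F' \<in> borel_measurable (X \<Otimes>\<^sub>M X)"
    unfolding F_def F'_def using mC by measurable
  have mH: "H \<in> borel_measurable (X \<Otimes>\<^sub>M X)" "H' \<in> borel_measurable (X \<Otimes>\<^sub>M X)"
    unfolding H_def H'_def using f h by measurable
  define W :: "'x \<times> 'x \<Rightarrow> ennreal" where "W = indicator (C \<times> C)"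
  have mW: "W \<in> borel_measurable (X \<Otimes>\<^sub>M X)"
    using C(1) by (auto simp: W_def)
  define W' :: "'x \<times> 'x \<Rightarrow> ennreal" where "W' = indicator (- (C \<times> C))"
  have mW': "W' \<in> borel_measurable (X \<Otimes>\<^sub>M X)"
  proof -
    have "indicator (space (X \<Otimes>\<^sub>M X) - C \<times> C) \<in> borel_measurable (X \<Otimes>\<^sub>M X)"
      using C(1) by auto
    then show ?thesis
      by (rule measurable_cong[THEN iffD1, rotated]) (auto simp: W'_def indicator_def)
  qed
  have M_eq: "nn_integral M u = (\<integral>\<^sup>+z. W z * u z \<partial>(p \<Otimes>\<^sub>M p'))"
    if u: "u \<in> borel_measurable (X \<Otimes>\<^sub>M X)" for u
  proof -
    have Cp: "C \<in> sets p" "C \<in> sets p'" using C s by auto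
    have "M = density (p \<Otimes>\<^sub>M p') (\<lambda>(x, y). indicator C x * indicator C y)"
      unfolding M_def pC_def using Cp finq[of p', unfolded pC_def]
      by (intro pair_measure_density) (auto simp: p'.sigma_finite_measure_axioms finite_measure_def)
    moreover have "(\<lambda>(x, y). indicator C x * indicator C y) = W"
      by (auto simp: W_def indicator_def)
    ultimately show ?thesis
      using u mW by (simp add: nn_integral_density measurable_cong_sets[OF sP refl])
  qed
  have m: "u \<in> borel_measurable (p \<Otimes>\<^sub>M p')" if "u \<in> borel_measurable (X \<Otimes>\<^sub>M X)" for u :: "_ \<Rightarrow> ennreal"
    using that by (simp add: measurable_cong_sets[OF sP refl])
  \<comment> \<open>Both sides are the product of the integrals of \<open>fC\<close> and
    \<open>hC\<close> under \<open>L\<close>; this is the cancellation of the symmetric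
    component.\<close>
  have eqN: "nn_integral N F = nn_integral N F'"
    using mC finL unfolding N_def F_def F'_def
    by (simp add: nn_integral_pair_mult sL measurable_cong_sets[OF sL refl]) (rule mult.commute)
  have c2: "c\<^sup>2 \<le> 1" using c by (simp add: power_le_one)
  have WF: "W z * F z = W z * H z" "W z * F' z = W z * H' z" for z
    by (auto simp: W_def F_def F'_def H_def H'_def fC_def hC_def indicator_def)
  have in_C: "F z \<le> F' z + W z * B0 z" if "z \<in> space M" for z
    using inside(1)[of "fst z" "snd z"]
    by (cases z) (auto simp: W_def F_def F'_def fC_def hC_def indicator_def)
  have "(\<integral>\<^sup>+z. W z * H z \<partial>(p \<Otimes>\<^sub>M p')) = nn_integral M F"
    using mF by (simp add: M_eq WF)
  also have "\<dots> \<le> nn_integral M F' + (\<integral>\<^sup>+z. ennreal (1 - c\<^sup>2) * (W z * B0 z) \<partial>M)"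
    using fin sM sN c2 lo up mF mW B0 in_C eqN
    by (intro nn_integral_le_contraction) (auto simp: measurable_cong_sets[OF sM refl])
  also have "(\<integral>\<^sup>+z. ennreal (1 - c\<^sup>2) * (W z * B0 z) \<partial>M) =
      (\<integral>\<^sup>+z. W z * (ennreal (1 - c\<^sup>2) * (W z * B0 z)) \<partial>(p \<Otimes>\<^sub>M p'))"
    using mW[measurable] B0[measurable] by (intro M_eq) measurable
  also have "\<dots> \<le> (\<integral>\<^sup>+z. W z * B z \<partial>(p \<Otimes>\<^sub>M p'))"
    using inside(2) by (intro nn_integral_mono) (auto simp: W_def indicator_def c_def)
  also have "nn_integral M F' = (\<integral>\<^sup>+z. W z * H' z \<partial>(p \<Otimes>\<^sub>M p'))"
    using mF by (simp add: M_eq WF)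
  finally have in_le: "(\<integral>\<^sup>+z. W z * H z \<partial>(p \<Otimes>\<^sub>M p')) \<le>
      (\<integral>\<^sup>+z. W z * H' z \<partial>(p \<Otimes>\<^sub>M p')) + (\<integral>\<^sup>+z. W z * B z \<partial>(p \<Otimes>\<^sub>M p'))"
    by (simp add: add_left_mono)
  note [measurable] = m[OF mF(1)] m[OF mF(2)] m[OF mH(1)] m[OF mH(2)] m[OF mW] m[OF mW'] m[OF B] m[OF B0]
  have split: "nn_integral (p \<Otimes>\<^sub>M p') u = (\<integral>\<^sup>+z. W z * u z \<partial>(p \<Otimes>\<^sub>M p')) + (\<integral>\<^sup>+z. W' z * u z \<partial>(p \<Otimes>\<^sub>M p'))"
    if [measurable]: "u \<in> borel_measurable (p \<Otimes>\<^sub>M p')" for u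
  proof -
    have "u z = W z * u z + W' z * u z" for z
      by (simp add: W_def W'_def indicator_def)
    then have "nn_integral (p \<Otimes>\<^sub>M p') u = (\<integral>\<^sup>+z. W z * u z + W' z * u z \<partial>(p \<Otimes>\<^sub>M p'))"
      by (rule nn_integral_cong)
    also have "\<dots> = (\<integral>\<^sup>+z. W z * u z \<partial>(p \<Otimes>\<^sub>M p')) + (\<integral>\<^sup>+z. W' z * u z \<partial>(p \<Otimes>\<^sub>M p'))"
      by (rule nn_integral_add) measurable
    finally show ?thesis .
  qed
  have "(\<integral>\<^sup>+z. W' z * H z \<partial>(p \<Otimes>\<^sub>M p')) \<le> (\<integral>\<^sup>+z. W' z * H' z + W' z * B z \<partial>(p \<Otimes>\<^sub>M p'))"
    using spP by (intro nn_integral_mono) (auto simp: W'_def H_def H'_def indicator_def intro!: outside)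
  also have "\<dots> = (\<integral>\<^sup>+z. W' z * H' z \<partial>(p \<Otimes>\<^sub>M p')) + (\<integral>\<^sup>+z. W' z * B z \<partial>(p \<Otimes>\<^sub>M p'))"
    by (rule nn_integral_add) measurable
  finally have "nn_integral (p \<Otimes>\<^sub>M p') H \<le> nn_integral (p \<Otimes>\<^sub>M p') H' + nn_integral (p \<Otimes>\<^sub>M p') B"
    by (rule add_mono[OF in_le, THEN ord_eq_le_trans[rotated], THEN ord_le_eq_trans])
       (simp_all add: split[OF m] mH B ac_simps)
  then show ?thesis
    using f h s p'.finite_measure_axioms unfolding H_def H'_def
    by (simp add: nn_integral_pair_mult measurable_cong_sets[OF s(1) refl] measurable_cong_sets[OF s(2) refl])
qed

section \<open>Backward integrals and drift\<close>

text \<open>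
  The likelihood at the starting point is included: an expectation of $V$ under $Q(x,\cdot)$ may be
  infinite where $g(x,y) = 0$, whereas $g(x,y)\,QV(x)$ is always controlled by
  $\Upsilon_{\mathsf X}(y) V(x)$.
\<close>

primrec backward_int ::
    "('x \<Rightarrow> 'x measure) \<Rightarrow> ('x \<Rightarrow> 'y \<Rightarrow> real) \<Rightarrow> (nat \<Rightarrow> 'y) \<Rightarrow> nat
      \<Rightarrow> ('x \<Rightarrow> ennreal) \<Rightarrow> 'x \<Rightarrow> ennreal" where
  "backward_int Q g y 0 f x = ennreal (g x (y 0)) * f x"
| "backward_int Q g y (Suc n) f x = ennreal (g x (y 0)) * (\<integral>\<^sup>+x'. backward_int Q g (\<lambda>i. y (Suc i)) n f x' \<partial>Q x)"

text \<open>\<open>path_int\<close> peels off the last time, \<open>backward_int\<close> the first.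
  Exposing the first step turns \<open>Q x\<close> into a new initial law, to which an induction
  hypothesis for arbitrary initial laws applies.\<close>

lemma path_int_Suc_front:
  "path_int Q g nu y (Suc n) f =
    (\<integral>\<^sup>+x. ennreal (g x (y 0)) * path_int Q g (Q x) (\<lambda>i. y (Suc i)) n f \<partial>nu)"
proof (induction n arbitrary: f)
  case (Suc n)
  show ?case
    unfolding path_int.simps(2)[of Q g nu y "Suc n"] Suc.IH by simp
qed simp

lemma path_int_eq_backward_int: "path_int Q g nu y n f = (\<integral>\<^sup>+x. backward_int Q g y n f x \<partial>nu)"
proof (induction n arbitrary: nu y)
  case (Suc n)
  show ?case
    unfolding path_int_Suc_front Suc.IH by simp
qed (auto intro!: nn_integral_cong)

locale filter_model =
  fixes X :: "'x measure" and Y :: "'y measure" and Q :: "'x \<Rightarrow> 'x measure"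
    and g :: "'x \<Rightarrow> 'y \<Rightarrow> real"
  assumes Q: "Q \<in> X \<rightarrow>\<^sub>M prob_algebra X"
    and g: "case_prod g \<in> borel_measurable (X \<Otimes>\<^sub>M Y)"
begin

lemma prob_space_Q: "x \<in> space X \<Longrightarrow> prob_space (Q x)"
  using measurable_space[OF Q] by (auto simp: space_prob_algebra)

lemma sets_Q: "x \<in> space X \<Longrightarrow> sets (Q x) = sets X"
  using measurable_space[OF Q] by (auto simp: space_prob_algebra)

lemma space_Q: "x \<in> space X \<Longrightarrow> space (Q x) = space X"
  using sets_Q by (auto dest: sets_eq_imp_space_eq)

lemma measurable_Q: "x \<in> space X \<Longrightarrow> measurable (Q x) M = measurable X M"
  by (rule measurable_cong_sets[OF sets_Q refl])

lemma measurable_likelihood: "y \<in> space Y \<Longrightarrow> (\<lambda>x. g x y) \<in> borel_measurable X"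
  using measurable_compose[OF measurable_Pair2' g] by simp

lemma measurable_kernel_integral:
  "f \<in> borel_measurable X \<Longrightarrow> (\<lambda>x. \<integral>\<^sup>+x'. f x' \<partial>Q x) \<in> borel_measurable X"
  using measurable_compose[OF measurable_prob_algebraD[OF Q] nn_integral_measurable_subprob_algebra] .

lemma backward_int_measurable:
  assumes f: "f \<in> borel_measurable X" and y: "\<And>i. y i \<in> space Y"
  shows "backward_int Q g y n f \<in> borel_measurable X"
  using y
proof (induction n arbitrary: y)
  case 0
  note measurable_likelihood[OF 0, measurable] f[measurable]
  show ?case by simp
next
  case (Suc n)
  note measurable_likelihood[OF Suc.prems, measurable]
    measurable_kernel_integral[OF Suc.IH, OF Suc.prems, measurable]
  show ?case by simp
qed

lemma backward_int_mono:
  assumes "\<And>x. x \<in> space X \<Longrightarrow> f x \<le> f' x" and "x \<in> space X"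
  shows "backward_int Q g y n f x \<le> backward_int Q g y n f' x"
  using assms(2)
proof (induction n arbitrary: x y)
  case 0
  with assms(1) show ?case by (simp add: mult_left_mono)
next
  case (Suc n)
  then show ?case
    by (auto intro!: mult_left_mono nn_integral_mono simp: space_Q)
qed

end

locale lyapunov_model = filter_model +
  fixes V :: "'a \<Rightarrow> real"
  assumes V_measurable [measurable]: "V \<in> borel_measurable X"
    and V_ge_1: "\<And>x. x \<in> space X \<Longrightarrow> 1 \<le> V x"
begin

lemma drift:
  assumes "x \<in> A" "x \<in> space X"
  shows "ennreal (g x y) * (\<integral>\<^sup>+x'. ennreal (V x') \<partial>Q x) \<le> Upsilon Q g V A y * ennreal (V x)"
proof -
  have V: "0 < ennreal (V x)" using V_ge_1[OF assms(2)] by simp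
  have "ennreal (g x y) * (\<integral>\<^sup>+x'. ennreal (V x') \<partial>Q x) =
      ennreal (g x y) * (\<integral>\<^sup>+x'. ennreal (V x') \<partial>Q x) / ennreal (V x) * ennreal (V x)"
    using V by (subst ennreal_divide_times) (simp add: ennreal_divide_self)
  also have "\<dots> \<le> Upsilon Q g V A y * ennreal (V x)"
    unfolding Upsilon_def using assms(1) by (intro mult_right_mono SUP_upper) auto
  finally show ?thesis .
qed

lemma kernel_V_ge_1: "x \<in> space X \<Longrightarrow> 1 \<le> (\<integral>\<^sup>+x'. ennreal (V x') \<partial>Q x)"
proof -
  assume x: "x \<in> space X"
  interpret Qx: prob_space "Q x" using x by (rule prob_space_Q)
  have "1 = (\<integral>\<^sup>+x'. 1 \<partial>Q x)" by (simp add: Qx.emeasure_space_1)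
  also have "\<dots> \<le> (\<integral>\<^sup>+x'. ennreal (V x') \<partial>Q x)"
    using x V_ge_1 by (intro nn_integral_mono) (auto simp: space_Q)
  finally show ?thesis .
qed

text \<open>Serves the last time, where no transition follows: the integral of \<open>V\<close>
  under \<open>Q x\<close> is at least 1, so it may be dropped from the drift inequality.\<close>

lemma likelihood_le: "x \<in> space X \<Longrightarrow> ennreal (g x y) \<le> Upsilon Q g V (space X) y * ennreal (V x)"
  using drift[of x "space X" y] mult_left_mono[OF kernel_V_ge_1, of x "ennreal (g x y)"]
  by (auto intro: order_trans)

text \<open>The factor \<open>V x\<close> carries the induction: the \<open>V\<close> left by the
  later times is integrated by \<open>Q x\<close>, and the likelihood at time 0 turns that integral
  back into \<open>V x\<close> at the cost of one more Upsilon.\<close>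

lemma backward_int_le_prod_Upsilon:
  "x \<in> space X \<Longrightarrow>
    backward_int Q g y n (\<lambda>_. 1) x \<le> (\<Prod>i\<le>n. Upsilon Q g V (space X) (y i)) * ennreal (V x)"
proof (induction n arbitrary: x y)
  case 0
  then show ?case using likelihood_le by simp
next
  case (Suc n)
  let ?P = "\<Prod>i\<le>n. Upsilon Q g V (space X) (y (Suc i))"
  have "(\<lambda>x'. ennreal (V x')) \<in> borel_measurable (Q x)"
    using Suc.prems by (simp add: measurable_Q)
  then have "(\<integral>\<^sup>+x'. backward_int Q g (\<lambda>i. y (Suc i)) n (\<lambda>_. 1) x' \<partial>Q x) \<le> ?P * (\<integral>\<^sup>+x'. ennreal (V x') \<partial>Q x)"
    using Suc by (subst nn_integral_cmult[symmetric]) (auto intro!: nn_integral_mono simp: space_Q)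
  then have "backward_int Q g y (Suc n) (\<lambda>_. 1) x \<le> ennreal (g x (y 0)) * (?P * (\<integral>\<^sup>+x'. ennreal (V x') \<partial>Q x))"
    by (simp add: mult_left_mono)
  also have "\<dots> = ?P * (ennreal (g x (y 0)) * (\<integral>\<^sup>+x'. ennreal (V x') \<partial>Q x))"
    by (simp add: ac_simps)
  also have "\<dots> \<le> ?P * (Upsilon Q g V (space X) (y 0) * ennreal (V x))"
    using Suc.prems by (intro mult_left_mono drift) auto
  also have "\<dots> = (\<Prod>i\<le>Suc n. Upsilon Q g V (space X) (y i)) * ennreal (V x)"
    by (simp only: prod.atMost_Suc_shift ac_simps)
  finally show ?case .
qed

end

section \<open>Contraction for a pair of chains\<close>

context lyapunov_model
begin

text \<open>A pair with a coordinate outside \<open>C\<close> gains \<open>1 / t\<^sup>2\<close>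
  from that coordinate if \<open>y \<in> K\<close>; if \<open>y \<notin> K\<close>, the last factor
  on the right advances the same amount. One power of \<open>t\<close> is spent at once on the left,
  the other remains on the right as \<open>1 / t\<close>.\<close>

lemma pair_drift:
  fixes t :: real
  assumes C: "\<forall>y\<in>K. Upsilon Q g V (space X - C) y \<le> ennreal (1 / t\<^sup>2) * Upsilon Q g V (space X) y"
    and t: "1 < t" and x: "x \<in> space X" "x' \<in> space X"
  shows "ennreal (g x y) * ennreal (g x' y) * ((if x \<in> C \<and> x' \<in> C then 1 else ennreal t) *
      ((\<integral>\<^sup>+u. ennreal (V u) \<partial>Q x) * (\<integral>\<^sup>+u. ennreal (V u) \<partial>Q x')))
    \<le> (if x \<in> C \<and> x' \<in> C then 1 else ennreal (1 / t)) * (ennreal (V x) * ennreal (V x')) *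
      ((Upsilon Q g V (space X) y)\<^sup>2 * (if y \<in> K then 1 else ennreal (t\<^sup>2)))"
    (is "?L \<le> ?R")
proof -
  define a where "a x = ennreal (g x y) * (\<integral>\<^sup>+u. ennreal (V u) \<partial>Q x)" for x
  define U where "U = Upsilon Q g V (space X) y"
  define v where "v x = ennreal (V x)" for x
  have L: "?L = (if x \<in> C \<and> x' \<in> C then 1 else ennreal t) * (a x * a x')"
    by (simp add: a_def ac_simps)
  have a: "a z \<le> U * v z" if "z \<in> space X" for z
    unfolding a_def U_def v_def using that by (intro drift) auto
  have a_out: "a z \<le> ennreal (1 / t\<^sup>2) * U * v z" if "z \<in> space X" "z \<notin> C" "y \<in> K" for z
  proof -
    have "a z \<le> Upsilon Q g V (space X - C) y * v z"
      unfolding a_def v_def using that by (intro drift) auto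
    also have "\<dots> \<le> ennreal (1 / t\<^sup>2) * U * v z"
      using C that(3) by (simp add: U_def mult_right_mono)
    finally show ?thesis .
  qed
  consider "x \<in> C" "x' \<in> C" | "\<not> (x \<in> C \<and> x' \<in> C)" "y \<in> K" | "\<not> (x \<in> C \<and> x' \<in> C)" "y \<notin> K"
    by blast
  then show ?thesis
  proof cases
    case 1
    have "a x * a x' \<le> (U * v x) * (U * v x')"
      using a x by (intro mult_mono) auto
    also have "\<dots> = (v x * v x') * (U\<^sup>2 * 1)"
      by (simp add: power2_eq_square ac_simps)
    also have "\<dots> \<le> (v x * v x') * (U\<^sup>2 * (if y \<in> K then 1 else ennreal (t\<^sup>2)))"
      using t by (intro mult_left_mono) (auto simp: ennreal_1[symmetric] simp del: ennreal_1)
    finally show ?thesis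
      using 1 unfolding L by (simp add: U_def v_def)
  next
    case 2
    have "a x * a x' \<le> ennreal (1 / t\<^sup>2) * ((U * v x) * (U * v x'))"
    proof (cases "x \<in> C")
      case True
      then have "a x * a x' \<le> (U * v x) * (ennreal (1 / t\<^sup>2) * U * v x')"
        using 2 a a_out x by (intro mult_mono) auto
      then show ?thesis by (simp add: ac_simps)
    next
      case False
      then have "a x * a x' \<le> (ennreal (1 / t\<^sup>2) * U * v x) * (U * v x')"
        using 2 a a_out x by (intro mult_mono) auto
      then show ?thesis by (simp add: ac_simps)
    qed
    then have "ennreal t * (a x * a x') \<le> ennreal t * (ennreal (1 / t\<^sup>2) * ((U * v x) * (U * v x')))"
      by (rule mult_left_mono) simp
    also have "\<dots> = (ennreal t * ennreal (1 / t\<^sup>2)) * ((U * v x) * (U * v x'))"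
      by (simp add: ac_simps)
    also have "ennreal t * ennreal (1 / t\<^sup>2) = ennreal (1 / t)"
      using t by (simp add: ennreal_mult[symmetric] power2_eq_square)
    finally show ?thesis
      using 2(2) unfolding L unfolding if_not_P[OF 2(1)] by (simp add: U_def v_def power2_eq_square ac_simps)
  next
    case 3
    have "ennreal t * (a x * a x') \<le> ennreal t * ((U * v x) * (U * v x'))"
      using a x by (intro mult_left_mono mult_mono) auto
    also have "\<dots> = ennreal (1 / t) * ennreal (t\<^sup>2) * ((U * v x) * (U * v x'))"
      using t by (simp add: ennreal_mult[symmetric] power2_eq_square)
    finally show ?thesis
      using 3(2) unfolding L unfolding if_not_P[OF 3(1)] by (simp add: U_def v_def power2_eq_square ac_simps)
  qed
qed

text \<open>The estimate at the last time, obtained from \<open>pair_drift\<close> by discarding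
  factors that are at least 1.\<close>

lemma likelihood_pair_le:
  fixes t :: real
  assumes C: "\<forall>y\<in>K. Upsilon Q g V (space X - C) y \<le> ennreal (1 / t\<^sup>2) * Upsilon Q g V (space X) y"
    and t: "1 < t" and x: "x \<in> space X" "x' \<in> space X"
  shows "ennreal (g x y) * ennreal (g x' y)
    \<le> (if x \<in> C \<and> x' \<in> C then 1 else ennreal (1 / t)) * (ennreal (V x) * ennreal (V x')) *
      ((Upsilon Q g V (space X) y)\<^sup>2 * (if y \<in> K then 1 else ennreal (t\<^sup>2)))"
proof -
  have t1: "1 \<le> (if x \<in> C \<and> x' \<in> C then 1 else ennreal t)"
    using t by (auto simp: ennreal_1[symmetric] simp del: ennreal_1)
  have "ennreal (g x y) * ennreal (g x' y) * (1 * (1 * 1)) \<le>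
      ennreal (g x y) * ennreal (g x' y) * ((if x \<in> C \<and> x' \<in> C then 1 else ennreal t) *
      ((\<integral>\<^sup>+u. ennreal (V u) \<partial>Q x) * (\<integral>\<^sup>+u. ennreal (V u) \<partial>Q x')))"
    by (rule mult_left_mono[OF mult_mono[OF t1 mult_mono[OF kernel_V_ge_1 kernel_V_ge_1]]])
       (use x in auto)
  also note pair_drift[OF C t x]
  finally show ?thesis by simp
qed

text \<open>
  Reading $s$ as a number of steps inside $\mathsf C \times \mathsf C$: such a step turns $s$ into
  $s - 1$, every other step uses up one of the factors $1/t$, which is recovered in the factor
  $t^{-2}$ of a state outside $\mathsf C \times \mathsf C$ shared by at most two steps; the factor
  $1/t$ of the initial pair keeps account of the half not yet spent.
\<close>

lemma backward_int_pair_contraction: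
  fixes t \<rho> :: real
  assumes LD: "LD_with X Q C lam lo up"
    and C: "\<forall>y\<in>K. Upsilon Q g V (space X - C) y \<le> ennreal (1 / t\<^sup>2) * Upsilon Q g V (space X) y"
    and t: "1 < t" and \<rho>: "\<rho> = 1 - (lo / up)\<^sup>2" "0 \<le> \<rho>"
    and f: "f \<in> borel_measurable X" "\<And>x. f x \<le> 1"
    and y: "\<And>i. y i \<in> space Y" and x: "x \<in> space X" "x' \<in> space X"
  shows "backward_int Q g y n f x * backward_int Q g y n (\<lambda>_. 1) x' \<le>
    backward_int Q g y n (\<lambda>_. 1) x * backward_int Q g y n f x' +
    (ennreal \<rho> ^ s * (backward_int Q g y n (\<lambda>_. 1) x * backward_int Q g y n (\<lambda>_. 1) x') +
     ennreal (1 / t) ^ n * ennreal t ^ s * ((if x \<in> C \<and> x' \<in> C then 1 else ennreal (1 / t)) *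
       (ennreal (V x) * ennreal (V x')) *
       (\<Prod>i\<le>n. (Upsilon Q g V (space X) (y i))\<^sup>2 * (if y i \<in> K then 1 else ennreal (t\<^sup>2)))))"
  using y x
proof (induction n arbitrary: y s x x')
  case (0 y)
  have t1: "1 \<le> ennreal t ^ s"
    using t by (intro one_le_power) (auto simp: ennreal_1[symmetric] simp del: ennreal_1)
  have "backward_int Q g y 0 f x * backward_int Q g y 0 (\<lambda>_. 1) x' \<le> ennreal (g x (y 0)) * ennreal (g x' (y 0))"
    using f(2) by (auto intro!: mult_right_mono mult_left_le)
  also have "\<dots> \<le> ennreal (1 / t) ^ 0 * ennreal t ^ s * ((if x \<in> C \<and> x' \<in> C then 1 else ennreal (1 / t)) *
       (ennreal (V x) * ennreal (V x')) *
       (\<Prod>i\<le>0. (Upsilon Q g V (space X) (y i))\<^sup>2 * (if y i \<in> K then 1 else ennreal (t\<^sup>2))))" (is "_ \<le> ?B")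
    using mult_mono[OF t1 likelihood_pair_le[OF C t 0(2,3), of "y 0"]] by simp
  finally show ?case
    by (meson add_increasing order_trans zero_le)
next
  case (Suc n y)
  define y' where "y' i = y (Suc i)" for i
  define \<phi> where "\<phi> = backward_int Q g y' n f"
  define h where "h = backward_int Q g y' n (\<lambda>_. 1)"
  define P where "P = (\<Prod>i\<le>n. (Upsilon Q g V (space X) (y' i))\<^sup>2 * (if y' i \<in> K then 1 else ennreal (t\<^sup>2)))"
  define v where "v x = ennreal (V x)" for x
  define b where "b = (if x \<in> C \<and> x' \<in> C then 1 else ennreal t)"
  have y': "y' i \<in> space Y" for i
    using Suc.prems(1) by (simp add: y'_def)
  have m: "\<phi> \<in> borel_measurable X" "h \<in> borel_measurable X" "v \<in> borel_measurable X"
    using f(1) y' by (auto simp: \<phi>_def h_def v_def[abs_def] intro!: backward_int_measurable)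
  note [measurable] = m
  have tr: "ennreal (1 / t) * ennreal t = 1"
    using t by (simp add: ennreal_mult[symmetric])
  have r1: "ennreal (1 / t) \<le> 1"
    using t by (auto simp: ennreal_1[symmetric] simp del: ennreal_1)
  have \<rho>1: "ennreal \<rho> \<le> 1"
    using \<rho> by (auto simp: ennreal_1[symmetric] simp del: ennreal_1)
  have \<phi>_le: "\<phi> u \<le> h u" if "u \<in> space X" for u
    unfolding \<phi>_def h_def using that f(2) by (intro backward_int_mono) auto
  define w where "w u u' = (if u \<in> C \<and> u' \<in> C then 1 else ennreal (1 / t))" for u u'
  have IH: "\<phi> u * h u' \<le> h u * \<phi> u' + (ennreal \<rho> ^ k * (h u * h u') +
      ennreal (1 / t) ^ n * ennreal t ^ k * (w u u' * (v u * v u') * P))"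
    if "u \<in> space X" "u' \<in> space X" for u u' k
    unfolding \<phi>_def h_def P_def v_def w_def using y' that by (rule Suc.IH)
  define I where "I f x = (\<integral>\<^sup>+u. f u \<partial>Q x)" for f :: "'a \<Rightarrow> ennreal" and x
  \<comment> \<open>The remainder at the next pair while the current pair is kept fixed. The weight
    \<open>b\<close> is an advance of \<open>t\<close> to a current pair outside
    \<open>C \<times> C\<close>; \<open>pair_drift\<close> repays it when the likelihoods at time 0
    are multiplied in.\<close>
  define B where "B z = ennreal \<rho> ^ s * (h (fst z) * h (snd z)) +
    ennreal (1 / t) ^ Suc n * ennreal t ^ s * b * P * (v (fst z) * v (snd z))" for z
  have mB: "B \<in> borel_measurable (X \<Otimes>\<^sub>M X)"
    unfolding B_def by measurable
  note x = Suc.prems(2,3)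
  interpret Qx: prob_space "Q x" using x(1) by (rule prob_space_Q)
  interpret Qx': prob_space "Q x'" using x(2) by (rule prob_space_Q)
  have sP: "sets (Q x \<Otimes>\<^sub>M Q x') = sets (X \<Otimes>\<^sub>M X)"
    using x by (intro sets_pair_measure_cong sets_Q)
  have mP: "measurable (Q x \<Otimes>\<^sub>M Q x') M = measurable (X \<Otimes>\<^sub>M X) M" for M
    using sP refl by (rule measurable_cong_sets)
  have I_pair: "(\<integral>\<^sup>+z. f (fst z) * f' (snd z) \<partial>(Q x \<Otimes>\<^sub>M Q x')) = I f x * I f' x'"
    if "f \<in> borel_measurable X" "f' \<in> borel_measurable X" for f f'
    unfolding I_def using that x
    by (intro nn_integral_pair_mult) (auto simp: measurable_Q Qx'.finite_measure_axioms)
  have I_B: "nn_integral (Q x \<Otimes>\<^sub>M Q x') B = ennreal \<rho> ^ s * (I h x * I h x') +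
      ennreal (1 / t) ^ Suc n * ennreal t ^ s * b * P * (I v x * I v x')"
    unfolding B_def by (simp add: nn_integral_add nn_integral_cmult mP I_pair)
  have step: "I \<phi> x * I h x' \<le> I h x * I \<phi> x' + nn_integral (Q x \<Otimes>\<^sub>M Q x') B"
  proof (cases "x \<in> C \<and> x' \<in> C")
    case False
    then have b: "b = ennreal t" by (auto simp: b_def)
    have le: "\<phi> (fst z) * h (snd z) \<le> h (fst z) * \<phi> (snd z) + B z"
      if zin: "z \<in> space (Q x \<Otimes>\<^sub>M Q x')" for z
    proof -
      obtain u u' where z: "z = (u, u')" "u \<in> space X" "u' \<in> space X"
        using zin x by (auto simp: space_pair_measure space_Q)
      \<comment> \<open>From a pair outside \<open>C \<times> C\<close> the parameter
        \<open>s\<close> is kept. The passage from \<open>n\<close> to \<open>Suc n\<close> factors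
        \<open>1 / t\<close> is balanced by \<open>b = ennreal t\<close>.\<close>
      have "w u u' \<le> 1" using r1 by (simp add: w_def)
      then have "w u u' * (v u * v u') * P \<le> 1 * (v u * v u') * P"
        by (intro mult_right_mono) auto
      also have "\<dots> = ennreal (1 / t) * b * P * (v u * v u')"
        unfolding b tr by (simp add: ac_simps)
      finally have "ennreal (1 / t) ^ n * ennreal t ^ s * (w u u' * (v u * v u') * P) \<le>
          ennreal (1 / t) ^ n * ennreal t ^ s * (ennreal (1 / t) * b * P * (v u * v u'))"
        by (rule mult_left_mono) simp
      also have "\<dots> = ennreal (1 / t) ^ Suc n * ennreal t ^ s * b * P * (v u * v u')"
        by (simp add: ac_simps)
      finally show ?thesis
        using IH[OF z(2,3), of s] unfolding z(1) B_def fst_conv snd_conv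
        by (meson add_left_mono order_trans)
    qed
    have "I \<phi> x * I h x' = (\<integral>\<^sup>+z. \<phi> (fst z) * h (snd z) \<partial>(Q x \<Otimes>\<^sub>M Q x'))"
      using m by (simp add: I_pair)
    also have "\<dots> \<le> (\<integral>\<^sup>+z. h (fst z) * \<phi> (snd z) + B z \<partial>(Q x \<Otimes>\<^sub>M Q x'))"
      using le by (rule nn_integral_mono)
    also have "\<dots> = I h x * I \<phi> x' + nn_integral (Q x \<Otimes>\<^sub>M Q x') B"
      using mB by (simp add: nn_integral_add I_pair mP)
    finally show ?thesis .
  next
    case True
    then have b: "b = 1" by (auto simp: b_def)
    show ?thesis
    proof (cases s)
      case 0
      \<comment> \<open>With \<open>s = 0\<close> no contraction is demanded: the first part of the
        remainder is already the full product of the integrals of \<open>h\<close>.\<close>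
      have "I \<phi> x \<le> I h x"
        unfolding I_def using \<phi>_le x by (intro nn_integral_mono) (auto simp: space_Q)
      then have "I \<phi> x * I h x' \<le> I h x * I h x'"
        by (rule mult_right_mono) simp
      then show ?thesis
        unfolding I_B 0 by (simp add: add_increasing add_increasing2)
    next
      case (Suc k)
      \<comment> \<open>If the next pair is again in \<open>C \<times> C\<close>, the hypothesis is
        used with \<open>k = s - 1\<close>: the contraction raises \<rho>^k to \<rho>^s, and the
        additional \<open>1 / t\<close> is offset by one more \<open>t\<close>. If it is elsewhere,
        the hypothesis is used with \<open>s\<close> itself, and the weight \<open>w\<close>
        supplies the additional \<open>1 / t\<close>.\<close>
      define B0 where "B0 z = ennreal \<rho> ^ k * (h (fst z) * h (snd z)) +
        ennreal (1 / t) ^ n * ennreal t ^ k * (v (fst z) * v (snd z) * P)" for z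
      have mB0: "B0 \<in> borel_measurable (X \<Otimes>\<^sub>M X)"
        unfolding B0_def by measurable
      have C_sub: "C \<subseteq> space X"
        using LD sets.sets_into_space by (auto simp: LD_with_def)
      show ?thesis
        unfolding I_def
      proof (rule doeblin_pair_contraction[of "Q x" "Q x'" X lam C lo up _ _ B0])
        show "\<phi> u * h u' \<le> h u * \<phi> u' + B0 (u, u')" if "u \<in> C" "u' \<in> C" for u u'
          using IH[of u u' k] C_sub that by (auto simp: B0_def w_def)
        show "ennreal (1 - (lo / up)\<^sup>2) * B0 (u, u') \<le> B (u, u')" for u u'
        proof -
          have "ennreal (1 / t) ^ n * ennreal t ^ k * (v u * v u' * P) =
              (ennreal (1 / t) * ennreal t) * (ennreal (1 / t) ^ n * ennreal t ^ k * (v u * v u' * P))"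
            unfolding tr by simp
          also have "\<dots> = ennreal (1 / t) ^ Suc n * ennreal t ^ s * b * P * (v u * v u')"
            unfolding Suc b by (simp add: ac_simps)
          finally have "ennreal \<rho> * (ennreal (1 / t) ^ n * ennreal t ^ k * (v u * v u' * P)) \<le>
              ennreal (1 / t) ^ Suc n * ennreal t ^ s * b * P * (v u * v u')"
            using mult_right_mono[OF \<rho>1] by simp
          moreover have "ennreal \<rho> * (ennreal \<rho> ^ k * (h u * h u')) = ennreal \<rho> ^ s * (h u * h u')"
            unfolding Suc by (simp add: ac_simps)
          ultimately show ?thesis
            unfolding \<rho>(1)[symmetric] B0_def B_def fst_conv snd_conv distrib_left
            by (intro add_mono) simp_all
        qed
        show "\<phi> u * h u' \<le> h u * \<phi> u' + B (u, u')"
          if "u \<in> space X" "u' \<in> space X" "\<not> (u \<in> C \<and> u' \<in> C)" for u u'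
        proof -
          have w: "w u u' = ennreal (1 / t)" unfolding w_def using that(3) by (rule if_not_P)
          show ?thesis
            using IH[OF that(1,2), of s] unfolding w B_def b by (simp add: ac_simps)
        qed
      qed (use LD True m mB mB0 x in \<open>auto simp: LD_with_def sets_Q prob_space_Q\<close>)
    qed
  qed
  \<comment> \<open>Only now are the likelihoods of the current pair attached, so that the integrals
    of \<open>V\<close> never occur without the factor that controls them.\<close>
  define G where "G = ennreal (g x (y 0)) * ennreal (g x' (y 0))"
  have bw: "backward_int Q g y (Suc n) f z = ennreal (g z (y 0)) * I \<phi> z"
    "backward_int Q g y (Suc n) (\<lambda>_. 1) z = ennreal (g z (y 0)) * I h z" for z
    by (simp_all add: I_def \<phi>_def h_def y'_def[abs_def])
  have "backward_int Q g y (Suc n) f x * backward_int Q g y (Suc n) (\<lambda>_. 1) x' = G * (I \<phi> x * I h x')"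
    unfolding bw G_def by (simp add: ac_simps)
  also have "\<dots> \<le> G * (I h x * I \<phi> x' + nn_integral (Q x \<Otimes>\<^sub>M Q x') B)"
    using step by (rule mult_left_mono) simp
  also have "\<dots> = backward_int Q g y (Suc n) (\<lambda>_. 1) x * backward_int Q g y (Suc n) f x' +
      (ennreal \<rho> ^ s * (backward_int Q g y (Suc n) (\<lambda>_. 1) x * backward_int Q g y (Suc n) (\<lambda>_. 1) x') +
       ennreal (1 / t) ^ Suc n * ennreal t ^ s * P * (G * (b * (I v x * I v x'))))"
    unfolding bw G_def I_B by (simp add: distrib_left ac_simps)
  also have "\<dots> \<le> backward_int Q g y (Suc n) (\<lambda>_. 1) x * backward_int Q g y (Suc n) f x' +
      (ennreal \<rho> ^ s * (backward_int Q g y (Suc n) (\<lambda>_. 1) x * backward_int Q g y (Suc n) (\<lambda>_. 1) x') +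
       ennreal (1 / t) ^ Suc n * ennreal t ^ s * P *
         ((if x \<in> C \<and> x' \<in> C then 1 else ennreal (1 / t)) * (v x * v x') *
          ((Upsilon Q g V (space X) (y 0))\<^sup>2 * (if y 0 \<in> K then 1 else ennreal (t\<^sup>2)))))"
    unfolding G_def b_def I_def v_def by (intro add_left_mono mult_left_mono pair_drift[OF C t x]) simp
  also have "ennreal (1 / t) ^ Suc n * ennreal t ^ s * P *
         ((if x \<in> C \<and> x' \<in> C then 1 else ennreal (1 / t)) * (v x * v x') *
          ((Upsilon Q g V (space X) (y 0))\<^sup>2 * (if y 0 \<in> K then 1 else ennreal (t\<^sup>2)))) =
      ennreal (1 / t) ^ Suc n * ennreal t ^ s * ((if x \<in> C \<and> x' \<in> C then 1 else ennreal (1 / t)) *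
        (v x * v x') *
        (\<Prod>i\<le>Suc n. (Upsilon Q g V (space X) (y i))\<^sup>2 * (if y i \<in> K then 1 else ennreal (t\<^sup>2))))"
    unfolding P_def y'_def prod.atMost_Suc_shift by (simp only: ac_simps)
  finally show ?case
    unfolding v_def .
qed

end

section \<open>Bounds for the filter\<close>

context filter_model
begin

lemma backward_int_cmult:
  assumes f: "f \<in> borel_measurable X" and y: "\<And>i. y i \<in> space Y" and "x \<in> space X"
  shows "backward_int Q g y n (\<lambda>x. c * f x) x = c * backward_int Q g y n f x"
  using y assms(3)
proof (induction n arbitrary: y x)
  case 0
  show ?case by (simp add: ac_simps)
next
  case (Suc n)
  have "backward_int Q g (\<lambda>i. y (Suc i)) n f \<in> borel_measurable (Q x)"
    using backward_int_measurable[OF f] Suc.prems by (simp add: measurable_Q)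
  moreover have "(\<integral>\<^sup>+u. backward_int Q g (\<lambda>i. y (Suc i)) n (\<lambda>x. c * f x) u \<partial>Q x) =
      (\<integral>\<^sup>+u. c * backward_int Q g (\<lambda>i. y (Suc i)) n f u \<partial>Q x)"
    using Suc.prems by (intro nn_integral_cong Suc.IH) (auto simp: space_Q)
  ultimately show ?case
    by (simp add: nn_integral_cmult ac_simps)
qed

lemma path_int_mono:
  assumes "sets nu = sets X" and "\<And>x. x \<in> space X \<Longrightarrow> f x \<le> f' x"
  shows "path_int Q g nu y n f \<le> path_int Q g nu y n f'"
  unfolding path_int_eq_backward_int using assms(1)
  by (intro nn_integral_mono backward_int_mono assms(2)) (auto dest: sets_eq_imp_space_eq)

lemma path_int_cmult:
  assumes nu: "sets nu = sets X" and f: "f \<in> borel_measurable X" and y: "\<And>i. y i \<in> space Y"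
  shows "path_int Q g nu y n (\<lambda>x. c * f x) = c * path_int Q g nu y n f"
proof -
  have "path_int Q g nu y n (\<lambda>x. c * f x) = (\<integral>\<^sup>+x. c * backward_int Q g y n f x \<partial>nu)"
    unfolding path_int_eq_backward_int using nu f y
    by (intro nn_integral_cong backward_int_cmult) (auto dest: sets_eq_imp_space_eq)
  then show ?thesis
    unfolding path_int_eq_backward_int using backward_int_measurable[OF f y]
    by (simp add: nn_integral_cmult measurable_cong_sets[OF nu refl])
qed

text \<open>The Doeblin bound on subsets of \<open>D\<close> is a comparison of two restricted
  measures, and therefore passes to the integral of the likelihood.\<close>

lemma LD_kernel_lower:
  assumes LD: "LD_with X Q D lam lo up" and x: "x \<in> D" and y: "y \<in> space Y"
  shows "ennreal lo * Psi g lam D y \<le> (\<integral>\<^sup>+x'. ennreal (g x' y) * indicator D x' \<partial>Q x)"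
proof -
  have D: "D \<in> sets X" "x \<in> space X" and lam: "sets lam = sets X"
    using LD x sets.sets_into_space by (auto simp: LD_with_def)
  note s = lam sets_Q[OF D(2)]
  have m: "measurable lam M = measurable X M" "measurable (Q x) M = measurable X M" for M
    using s by (auto intro: measurable_cong_sets)
  note measurable_likelihood[OF y, measurable] D(1)[measurable]
  have "nn_integral (scale_measure (ennreal lo) (density lam (indicator D))) (\<lambda>x. ennreal (g x y)) \<le>
      nn_integral (density (Q x) (indicator D)) (\<lambda>x. ennreal (g x y))"
  proof (rule nn_integral_mono_emeasure)
    fix A assume "A \<in> sets (density (Q x) (indicator D))"
    then have A: "A \<in> sets X" by (simp add: s)
    have "emeasure (density q (indicator D)) A = emeasure q (A \<inter> D)" if "sets q = sets X" for q
      using that A D(1)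
      by (simp add: emeasure_density Int_commute flip: nn_integral_restrict_space indicator_inter_arith)
    then show "emeasure (scale_measure (ennreal lo) (density lam (indicator D))) A
        \<le> emeasure (density (Q x) (indicator D)) A"
      using LD x A s by (auto simp: LD_with_def)
  qed (simp add: s)
  moreover have "nn_integral (scale_measure (ennreal lo) (density lam (indicator D))) (\<lambda>x. ennreal (g x y)) =
      ennreal lo * Psi g lam D y"
    unfolding Psi_def by (simp add: nn_integral_scale_measure nn_integral_density m mult.commute)
  moreover have "nn_integral (density (Q x) (indicator D)) (\<lambda>x. ennreal (g x y)) =
      (\<integral>\<^sup>+x'. ennreal (g x' y) * indicator D x' \<partial>Q x)"
    by (simp add: nn_integral_density m mult.commute)
  ultimately show ?thesis by simp
qed

text \<open>The chain is confined to \<open>D\<close> from time 1 on. The initial state is left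
  free, because \<open>nu\<close> may give \<open>D\<close> no mass; this is why times 0 and 1 enter
  through \<open>Phi\<close> and the product starts at 2.\<close>

lemma path_int_lower:
  assumes nu: "sets nu = sets X" and LD: "LD_with X Q D lam lo up" and y: "\<And>i. y i \<in> space Y"
    and n: "1 \<le> n"
  shows "Phi Q g nu D (y 0) (y 1) * (\<Prod>i=2..n. ennreal lo * Psi g lam D (y i)) \<le>
    path_int Q g nu y n (indicator D)"
  using n
proof (induction n rule: dec_induct)
  case base
  show ?case by (simp add: Phi_def)
next
  case (step n)
  have D: "D \<in> sets X" using LD by (simp add: LD_with_def)
  let ?c = "ennreal lo * Psi g lam D (y (Suc n))"
  have "Phi Q g nu D (y 0) (y 1) * (\<Prod>i=2..Suc n. ennreal lo * Psi g lam D (y i)) =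
      ?c * (Phi Q g nu D (y 0) (y 1) * (\<Prod>i=2..n. ennreal lo * Psi g lam D (y i)))"
    using step(1) by (simp add: prod.nat_ivl_Suc' ac_simps)
  also have "\<dots> \<le> ?c * path_int Q g nu y n (indicator D)"
    by (rule mult_left_mono[OF step.IH]) simp
  also have "\<dots> = path_int Q g nu y n (\<lambda>x. ?c * indicator D x)"
    using D by (intro path_int_cmult[symmetric] nu y) simp
  also have "\<dots> \<le> path_int Q g nu y (Suc n) (indicator D)"
    unfolding path_int.simps using LD_kernel_lower[OF LD _ y]
    by (intro path_int_mono nu) (auto simp: indicator_def)
  finally show ?case .
qed

end

context lyapunov_model
begin

text \<open>Supplies the finiteness of the normalising constant when \<open>V\<close> is integrable
  under \<open>nu\<close>.\<close>

lemma path_int_upper: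
  assumes nu: "sets nu = sets X"
  shows "path_int Q g nu y n (\<lambda>_. 1) \<le>
    (\<Prod>i\<le>n. Upsilon Q g V (space X) (y i)) * (\<integral>\<^sup>+x. ennreal (V x) \<partial>nu)"
proof -
  have "path_int Q g nu y n (\<lambda>_. 1) \<le>
      (\<integral>\<^sup>+x. (\<Prod>i\<le>n. Upsilon Q g V (space X) (y i)) * ennreal (V x) \<partial>nu)"
    unfolding path_int_eq_backward_int using nu
    by (intro nn_integral_mono backward_int_le_prod_Upsilon) (auto dest: sets_eq_imp_space_eq)
  then show ?thesis
    by (simp add: nn_integral_cmult measurable_cong_sets[OF nu refl])
qed

text \<open>
  Excludes $\infty - \infty$ in the sums of logarithms of $\Psi_{\mathsf D}$.
\<close>

lemma Psi_finite:
  assumes LD: "LD_with X Q D lam lo up" and y: "y \<in> space Y"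
    and U: "Upsilon Q g V (space X) y \<noteq> \<infinity>"
  shows "Psi g lam D y \<noteq> \<infinity>"
\<comment> \<open>A point of \<open>D\<close> with a finite integral of \<open>V\<close> bounds
  \<open>Psi\<close> through \<open>LD_kernel_lower\<close>. If there is none, finiteness of Upsilon
  forces the likelihood to vanish on \<open>D\<close>.\<close>
proof (cases "\<exists>x\<in>D. (\<integral>\<^sup>+u. ennreal (V u) \<partial>Q x) \<noteq> \<infinity>")
  case True
  then obtain x where x: "x \<in> D" "(\<integral>\<^sup>+u. ennreal (V u) \<partial>Q x) \<noteq> \<infinity>" by blast
  have xX: "x \<in> space X"
    using LD x sets.sets_into_space by (auto simp: LD_with_def)
  have "ennreal lo * Psi g lam D y \<le> (\<integral>\<^sup>+u. ennreal (g u y) * indicator D u \<partial>Q x)"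
    using LD x(1) y by (rule LD_kernel_lower)
  also have "\<dots> \<le> (\<integral>\<^sup>+u. Upsilon Q g V (space X) y * ennreal (V u) \<partial>Q x)"
    using xX likelihood_le by (intro nn_integral_mono) (auto simp: space_Q indicator_def)
  also have "\<dots> = Upsilon Q g V (space X) y * (\<integral>\<^sup>+u. ennreal (V u) \<partial>Q x)"
    using xX by (intro nn_integral_cmult) (simp add: measurable_Q)
  also have "\<dots> < \<infinity>"
    using U x(2) by (simp add: ennreal_mult_less_top less_top)
  finally show ?thesis
    using LD by (auto simp: LD_with_def ennreal_mult_less_top)
next
  case False
  have "ennreal (g x y) = 0" if "x \<in> D" for x
  proof (rule ccontr)
    assume "ennreal (g x y) \<noteq> 0"
    with False that have "ennreal (g x y) * (\<integral>\<^sup>+u. ennreal (V u) \<partial>Q x) = \<infinity>"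
      by (auto simp: ennreal_mult_eq_top_iff)
    moreover have "x \<in> space X"
      using LD that sets.sets_into_space by (auto simp: LD_with_def)
    ultimately have "\<infinity> \<le> Upsilon Q g V (space X) y * ennreal (V x)"
      using drift[of x "space X" y] by simp
    with U show False
      by (auto simp: top_unique ennreal_mult_eq_top_iff)
  qed
  then have "Psi g lam D y = (\<integral>\<^sup>+x. 0 \<partial>lam)"
    unfolding Psi_def by (intro nn_integral_cong) (auto simp: indicator_def)
  then show ?thesis by simp
qed

text \<open>The pointwise inequality is integrated over independent starting points. The integrals
  factorise, which produces the product of the two integrals of \<open>V\<close>; the weight of the
  initial pair is bounded by 1.\<close>

lemma path_int_pair_contraction:
  fixes t \<rho> :: real
  assumes nu: "prob_space nu" "sets nu = sets X" and nu': "prob_space nu'" "sets nu' = sets X"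
    and LD: "LD_with X Q C lam lo up"
    and C: "\<forall>y\<in>K. Upsilon Q g V (space X - C) y \<le> ennreal (1 / t\<^sup>2) * Upsilon Q g V (space X) y"
    and t: "1 < t" and \<rho>: "\<rho> = 1 - (lo / up)\<^sup>2" "0 \<le> \<rho>"
    and f: "f \<in> borel_measurable X" "\<And>x. f x \<le> 1"
    and y: "\<And>i. y i \<in> space Y"
  shows "path_int Q g nu y n f * path_int Q g nu' y n (\<lambda>_. 1) \<le>
    path_int Q g nu y n (\<lambda>_. 1) * path_int Q g nu' y n f +
    (ennreal \<rho> ^ s * (path_int Q g nu y n (\<lambda>_. 1) * path_int Q g nu' y n (\<lambda>_. 1)) +
     ennreal (1 / t) ^ n * ennreal t ^ s *
       ((\<integral>\<^sup>+x. ennreal (V x) \<partial>nu) * (\<integral>\<^sup>+x. ennreal (V x) \<partial>nu') *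
       (\<Prod>i\<le>n. (Upsilon Q g V (space X) (y i))\<^sup>2 * (if y i \<in> K then 1 else ennreal (t\<^sup>2)))))"
proof -
  interpret nu: prob_space nu by fact
  interpret nu': prob_space nu' by fact
  define \<phi> where "\<phi> = backward_int Q g y n f"
  define h where "h = backward_int Q g y n (\<lambda>_. 1)"
  define v where "v x = ennreal (V x)" for x
  define P where "P = (\<Prod>i\<le>n. (Upsilon Q g V (space X) (y i))\<^sup>2 * (if y i \<in> K then 1 else ennreal (t\<^sup>2)))"
  have m: "\<phi> \<in> borel_measurable X" "h \<in> borel_measurable X" "v \<in> borel_measurable X"
    using f(1) y by (auto simp: \<phi>_def h_def v_def[abs_def] intro!: backward_int_measurable)
  note [measurable] = m
  have mP: "measurable (nu \<Otimes>\<^sub>M nu') M = measurable (X \<Otimes>\<^sub>M X) M" for M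
    using nu nu' by (intro measurable_cong_sets sets_pair_measure_cong refl)
  have pair: "(\<integral>\<^sup>+z. f (fst z) * f' (snd z) \<partial>(nu \<Otimes>\<^sub>M nu')) = nn_integral nu f * nn_integral nu' f'"
    if "f \<in> borel_measurable X" "f' \<in> borel_measurable X" for f f'
    using that nu nu'
    by (intro nn_integral_pair_mult)
       (auto simp: measurable_cong_sets[OF nu(2) refl] measurable_cong_sets[OF nu'(2) refl]
         nu'.finite_measure_axioms)
  have r1: "ennreal (1 / t) \<le> 1"
    using t by (auto simp: ennreal_1[symmetric] simp del: ennreal_1)
  have le: "\<phi> (fst z) * h (snd z) \<le> h (fst z) * \<phi> (snd z) + (ennreal \<rho> ^ s * (h (fst z) * h (snd z)) +
      ennreal (1 / t) ^ n * ennreal t ^ s * P * (v (fst z) * v (snd z)))"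
    if zin: "z \<in> space (nu \<Otimes>\<^sub>M nu')" for z
  proof -
    have z: "fst z \<in> space X" "snd z \<in> space X"
      using zin nu(2) nu'(2) by (auto simp: space_pair_measure dest!: sets_eq_imp_space_eq)
    note backward_int_pair_contraction[where f = f and y = y and n = n and s = s, OF LD C t \<rho> f y z, folded P_def]
    also have "ennreal (1 / t) ^ n * ennreal t ^ s * ((if fst z \<in> C \<and> snd z \<in> C then 1 else ennreal (1 / t)) *
       (ennreal (V (fst z)) * ennreal (V (snd z))) * P) \<le>
       ennreal (1 / t) ^ n * ennreal t ^ s * (1 * (ennreal (V (fst z)) * ennreal (V (snd z))) * P)"
      using r1 by (intro mult_left_mono mult_right_mono) auto
    finally show ?thesis
      unfolding \<phi>_def h_def v_def P_def by (simp add: add_left_mono ac_simps)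
  qed
  have "path_int Q g nu y n f * path_int Q g nu' y n (\<lambda>_. 1) =
      (\<integral>\<^sup>+z. \<phi> (fst z) * h (snd z) \<partial>(nu \<Otimes>\<^sub>M nu'))"
    using m by (simp add: pair path_int_eq_backward_int \<phi>_def h_def)
  also have "\<dots> \<le> (\<integral>\<^sup>+z. h (fst z) * \<phi> (snd z) + (ennreal \<rho> ^ s * (h (fst z) * h (snd z)) +
      ennreal (1 / t) ^ n * ennreal t ^ s * P * (v (fst z) * v (snd z))) \<partial>(nu \<Otimes>\<^sub>M nu'))"
    using le by (rule nn_integral_mono)
  also have "\<dots> = nn_integral nu h * nn_integral nu' \<phi> + (ennreal \<rho> ^ s * (nn_integral nu h * nn_integral nu' h) +
      ennreal (1 / t) ^ n * ennreal t ^ s * P * (nn_integral nu v * nn_integral nu' v))"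
    by (simp add: nn_integral_add nn_integral_cmult mP pair)
  finally show ?thesis
    unfolding path_int_eq_backward_int \<phi>_def h_def v_def[abs_def] P_def by (simp add: ac_simps)
qed

end

section \<open>Total variation distance between two filters\<close>

lemma tv_dist_le:
  assumes "\<And>A. A \<in> sets M \<Longrightarrow> ennreal \<bar>measure M A - measure N A\<bar> \<le> c"
  shows "ennreal (tv_dist M N) \<le> c"
proof (cases c)
  case (real r)
  then have "\<bar>measure M A - measure N A\<bar> \<le> r" if "A \<in> sets M" for A
    using assms[OF that] by simp
  then have "tv_dist M N \<le> r"
    unfolding tv_dist_def using sets.top by (intro cSUP_least) auto
  then show ?thesis
    using real by (simp add: ennreal_leI)
qed simp

context filter_model
begin

lemma sets_filt: "sets phi0 = sets X \<Longrightarrow> sets (filt X Q g phi0 nu n y) = sets X"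
  by (simp add: filt_def sets.sets_measure_of_eq)

lemma measure_filt_le_1:
  assumes "prob_space phi0" "sets nu = sets X" and y: "\<And>i. y i \<in> space Y" and A: "A \<in> sets X"
  shows "measure (filt X Q g phi0 nu n y) A \<le> 1"
proof (cases "path_int Q g nu y n (\<lambda>_. 1) \<in> {0, \<infinity>}")
  case True
  with assms(1) show ?thesis
    by (simp add: filt_def prob_space.prob_le_1)
next
  case False
  have "path_int Q g nu y n (indicator A) \<le> path_int Q g nu y n (\<lambda>_. 1)"
    by (intro path_int_mono assms) (simp add: indicator_def)
  with False have "path_int Q g nu y n (indicator A) / path_int Q g nu y n (\<lambda>_. 1) \<le> 1"
    by (metis divide_right_mono_ennreal ennreal_divide_self insertCI less_top infinity_ennreal_def)
  then show ?thesis
    using False emeasure_filt[OF Q g assms(2) y _ _ A]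
    by (simp add: measure_def enn2real_leI)
qed

lemma tv_dist_filt_le_1:
  assumes "prob_space phi0" "sets phi0 = sets X" "sets nu = sets X" "sets nu' = sets X"
    and y: "\<And>i. y i \<in> space Y"
  shows "ennreal (tv_dist (filt X Q g phi0 nu n y) (filt X Q g phi0 nu' n y)) \<le> 1"
proof (rule tv_dist_le)
  fix A assume "A \<in> sets (filt X Q g phi0 nu n y)"
  then have A: "A \<in> sets X" using assms(2) by (simp add: sets_filt)
  have "\<bar>measure (filt X Q g phi0 nu n y) A - measure (filt X Q g phi0 nu' n y) A\<bar> \<le> 1"
    using measure_filt_le_1[where y = y and n = n, OF assms(1,3) y A]
      measure_filt_le_1[where y = y and n = n, OF assms(1,4) y A]
      measure_nonneg[of "filt X Q g phi0 nu n y" A] measure_nonneg[of "filt X Q g phi0 nu' n y" A]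
    by linarith
  then show "ennreal \<bar>measure (filt X Q g phi0 nu n y) A - measure (filt X Q g phi0 nu' n y) A\<bar> \<le> 1"
    by simp
qed

text \<open>The difference of two quotients after clearing denominators. Both orders of the two laws
  are required, since the absolute value has to be bounded.\<close>

lemma tv_dist_filt_le:
  assumes phi0: "sets phi0 = sets X"
    and nu: "sets nu = sets X" "path_int Q g nu y n (\<lambda>_. 1) \<notin> {0, \<infinity>}"
    and nu': "sets nu' = sets X" "path_int Q g nu' y n (\<lambda>_. 1) \<notin> {0, \<infinity>}"
    and y: "\<And>i. y i \<in> space Y"
    and le: "\<And>A. A \<in> sets X \<Longrightarrow> path_int Q g nu y n (indicator A) * path_int Q g nu' y n (\<lambda>_. 1) \<le>
      path_int Q g nu y n (\<lambda>_. 1) * path_int Q g nu' y n (indicator A) +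
      c * (path_int Q g nu y n (\<lambda>_. 1) * path_int Q g nu' y n (\<lambda>_. 1))"
    and le': "\<And>A. A \<in> sets X \<Longrightarrow> path_int Q g nu' y n (indicator A) * path_int Q g nu y n (\<lambda>_. 1) \<le>
      path_int Q g nu' y n (\<lambda>_. 1) * path_int Q g nu y n (indicator A) +
      c * (path_int Q g nu y n (\<lambda>_. 1) * path_int Q g nu' y n (\<lambda>_. 1))"
  shows "ennreal (tv_dist (filt X Q g phi0 nu n y) (filt X Q g phi0 nu' n y)) \<le> c"
proof (rule tv_dist_le)
  fix A assume "A \<in> sets (filt X Q g phi0 nu n y)"
  then have A: "A \<in> sets X" using phi0 by (simp add: sets_filt)
  obtain a where a: "path_int Q g nu y n (\<lambda>_. 1) = ennreal a" "0 < a"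
    using nu(2) by (cases "path_int Q g nu y n (\<lambda>_. 1)") auto
  obtain a' where a': "path_int Q g nu' y n (\<lambda>_. 1) = ennreal a'" "0 < a'"
    using nu'(2) by (cases "path_int Q g nu' y n (\<lambda>_. 1)") auto
  have "path_int Q g nu y n (indicator A) \<le> path_int Q g nu y n (\<lambda>_. 1)"
    by (intro path_int_mono nu) (simp add: indicator_def)
  then obtain b where b: "path_int Q g nu y n (indicator A) = ennreal b" "0 \<le> b"
    using a by (cases "path_int Q g nu y n (indicator A)") (auto simp: top_unique)
  have "path_int Q g nu' y n (indicator A) \<le> path_int Q g nu' y n (\<lambda>_. 1)"
    by (intro path_int_mono nu') (simp add: indicator_def)
  then obtain b' where b': "path_int Q g nu' y n (indicator A) = ennreal b'" "0 \<le> b'"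
    using a' by (cases "path_int Q g nu' y n (indicator A)") (auto simp: top_unique)
  have ma: "measure (filt X Q g phi0 nu n y) A = b / a"
    using emeasure_filt[OF Q g nu(1) y _ _ A, where n = n] a b by (simp add: measure_def divide_ennreal)
  have ma': "measure (filt X Q g phi0 nu' n y) A = b' / a'"
    using emeasure_filt[OF Q g nu'(1) y _ _ A, where n = n] a' b' by (simp add: measure_def divide_ennreal)
  show "ennreal \<bar>measure (filt X Q g phi0 nu n y) A - measure (filt X Q g phi0 nu' n y) A\<bar> \<le> c"
  proof (cases c)
    case (real r)
    have "b * a' \<le> a * b' + r * (a * a')" "b' * a \<le> a' * b + r * (a * a')"
      using le[OF A] le'[OF A] a a' b b' real
      by (simp_all add: ennreal_mult[symmetric] ennreal_plus[symmetric] del: ennreal_plus)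
    then have "\<bar>b / a - b' / a'\<bar> \<le> r"
      using a a' by (simp add: abs_le_iff field_simps)
    with real show ?thesis
      unfolding ma ma' by (simp add: ennreal_leI)
  qed simp
qed

end

section \<open>Logarithms, outer probabilities and rates\<close>

text \<open>Infinite factors are excluded because \<open>0 * \<infinity> = 0\<close> has logarithm
  \<open>-\<infinity>\<close>, while the sum of the logarithms would be
  \<open>\<infinity>\<close>.\<close>

lemma elog_mult: "x \<noteq> \<infinity> \<Longrightarrow> y \<noteq> \<infinity> \<Longrightarrow> elog (x * y) = elog x + elog y"
  by (cases x; cases y) (auto simp: elog_def ennreal_mult[symmetric] ln_mult)

lemma elog_prod:
  assumes "\<And>i. i \<in> I \<Longrightarrow> u i \<noteq> \<infinity>"
  shows "elog (\<Prod>i\<in>I. u i) = (\<Sum>i\<in>I. elog (u i))"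
proof (cases "finite I")
  case True
  then show ?thesis
    using assms
  proof (induction I)
    case (insert i I)
    then have "(\<Prod>i\<in>I. u i) \<noteq> \<infinity>"
      by (simp add: ennreal_prod_eq_top)
    with insert show ?case
      by (simp add: elog_mult)
  qed (simp add: elog_def zero_ereal_def)
qed (simp add: elog_def zero_ereal_def)

lemma exp_le_of_elog: "\<not> elog x \<le> ereal c \<Longrightarrow> ennreal (exp c) \<le> x"
proof (cases x)
  case (real r)
  assume "\<not> elog x \<le> ereal c"
  with real have "0 < r" "c < ln r"
    by (auto simp: elog_def split: if_splits)
  then have "exp c \<le> r"
    by (metis exp_less_mono exp_ln less_imp_le)
  with real show ?thesis by (simp add: ennreal_leI)
qed simp

lemma le_exp_of_elog: "\<not> ereal c \<le> elog x \<Longrightarrow> x \<le> ennreal (exp c)"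
proof (cases x)
  case (real r)
  assume *: "\<not> ereal c \<le> elog x"
  show ?thesis
  proof (cases "r = 0")
    case False
    with real * have "0 < r" "ln r < c"
      by (auto simp: elog_def split: if_splits)
    then have "r \<le> exp c"
      by (metis exp_less_mono exp_ln less_imp_le)
    with real show ?thesis by (simp add: ennreal_leI)
  qed (simp add: real)
qed (auto simp: elog_def)

text \<open>Rests on the convention that \<open>\<infinity>\<close> absorbs
  \<open>-\<infinity>\<close> in sums: one infinite term already makes the whole sum
  infinite.\<close>

lemma elog_sum_less_finite:
  assumes "finite I" "\<not> ereal c \<le> (\<Sum>i\<in>I. elog (u i))" "i \<in> I"
  shows "u i \<noteq> \<infinity>"
proof
  assume "u i = \<infinity>"
  then have "elog (u i) = \<infinity>" by (simp add: elog_def)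
  with assms show False
    using sum_Pinfty[of "\<lambda>i. elog (u i)" I] by auto
qed

text \<open>Each outer probability is attained by a measurable cover, and the union of the covers is
  again measurable.\<close>

lemma event_prob_disj_le: "event_prob P (\<lambda>w. R w \<or> S w) \<le> event_prob P R + event_prob P S"
proof -
  obtain A where A: "A \<in> sets P" "{w \<in> space P. R w} \<subseteq> A" "event_prob P R = emeasure P A"
    unfolding event_prob_def using outer_measure_of_attain[of "{w \<in> space P. R w}" P] by auto
  obtain B where B: "B \<in> sets P" "{w \<in> space P. S w} \<subseteq> B" "event_prob P S = emeasure P B"
    unfolding event_prob_def using outer_measure_of_attain[of "{w \<in> space P. S w}" P] by auto
  have "event_prob P (\<lambda>w. R w \<or> S w) \<le> outer_measure_of P (A \<union> B)"
    unfolding event_prob_def using A B by (intro outer_measure_of_mono) auto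
  also have "\<dots> \<le> emeasure P A + emeasure P B"
    using A(1) B(1) by (simp add: emeasure_subadditive)
  finally show ?thesis using A B by simp
qed

text \<open>Measurability of the event and of \<open>f\<close> is avoided: \<open>f\<close> lies
  below \<open>c\<close> plus the indicator of a measurable cover of the event, and
  \<open>nn_integral\<close> is monotone for arbitrary functions.\<close>

lemma nn_integral_le_event_prob:
  assumes P: "prob_space P"
    and "\<And>w. w \<in> space P \<Longrightarrow> f w \<le> 1" "\<And>w. w \<in> space P \<Longrightarrow> \<not> R w \<Longrightarrow> f w \<le> c"
  shows "(\<integral>\<^sup>+w. f w \<partial>P) \<le> c + event_prob P R"
proof -
  interpret P: prob_space P by fact
  obtain A where A: "A \<in> sets P" "{w \<in> space P. R w} \<subseteq> A" "event_prob P R = emeasure P A"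
    unfolding event_prob_def using outer_measure_of_attain[of "{w \<in> space P. R w}" P] by auto
  have "f w \<le> c + indicator A w" if "w \<in> space P" for w
  proof (cases "R w")
    case True
    with A(2) that assms(2)[OF that] show ?thesis
      by (auto simp: add_increasing)
  next
    case False
    with assms(3)[OF that] show ?thesis
      by (simp add: add_increasing2)
  qed
  then have "(\<integral>\<^sup>+w. f w \<partial>P) \<le> (\<integral>\<^sup>+w. c + indicator A w \<partial>P)"
    by (rule nn_integral_mono)
  also have "\<dots> = c + emeasure P A"
    using A(1) by (simp add: nn_integral_add P.emeasure_space_1)
  finally show ?thesis using A(3) by simp
qed

text \<open>The total exponent of \<open>t\<close> is at most - n + \<gamma> n / 4 + \<gamma> n / 4
  + (1 - \<gamma>) n = - \<gamma> n / 2, and t^(\<gamma>/2) = 2 E.\<close>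

lemma exponent_balance:
  fixes \<gamma> E :: real
  assumes \<gamma>: "0 < \<gamma>" and E: "1 \<le> E" and t: "t = (2 * E) powr (2 / \<gamma>)"
    and s: "real s \<le> \<gamma> * n / 4" and n: "2 \<le> \<gamma> * n / 4" and m: "2 * real m \<le> (1 - \<gamma>) * n"
  shows "(1 / t) ^ n * t ^ s * t ^ (2 + 2 * m) * E ^ n \<le> (1 / 2) ^ n"
proof -
  have t1: "1 \<le> t"
    unfolding t using \<gamma> E by (intro ge_one_powr_ge_zero) auto
  have pow: "t ^ k = t powr real k" for k
    using t1 by (simp add: powr_realpow)
  have "(1 / t) ^ n * t ^ s * t ^ (2 + 2 * m) = t powr (- real n) * t powr s * t powr real (2 + 2 * m)"
    unfolding power_one_over pow powr_minus by (simp add: divide_inverse)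
  also have "\<dots> = t powr (- real n + s + real (2 + 2 * m))"
    by (simp only: powr_add)
  also have "\<dots> \<le> t powr (- (\<gamma> * n / 2))"
    using t1 s n m by (intro powr_mono) (auto simp: algebra_simps)
  also have "\<dots> = (2 * E) powr (- real n)"
    using \<gamma> unfolding t by (simp add: powr_powr)
  also have "\<dots> = (1 / 2) ^ n / E ^ n"
    using E by (simp add: powr_minus powr_realpow power_mult_distrib power_divide divide_simps)
  finally show ?thesis
    using E by (simp add: field_simps)
qed

lemma geometric_rate:
  fixes \<gamma> \<rho> :: real
  assumes \<gamma>: "0 < \<gamma>" and \<rho>: "0 \<le> \<rho>" "\<rho> < 1"
  obtains \<beta> :: real where "1 / 2 \<le> \<beta>" "\<beta> < 1"
    "\<And>n. \<gamma> * real n < 8 \<Longrightarrow> 1 / 2 \<le> \<beta> ^ n"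
    "\<And>n. 8 \<le> \<gamma> * real n \<Longrightarrow> \<rho> ^ nat \<lfloor>\<gamma> * n / 4\<rfloor> \<le> \<beta> ^ n"
proof -
  \<comment> \<open>Keeps the base of \<open>powr\<close> positive even if \<rho> is 0, and gives
    the lower bound 1/2 needed for small n.\<close>
  define \<rho>' where "\<rho>' = max \<rho> (1 / 2)"
  have \<rho>': "1 / 2 \<le> \<rho>'" "\<rho>' < 1" "\<rho> \<le> \<rho>'"
    using \<rho> by (auto simp: \<rho>'_def)
  \<comment> \<open>The entry 1/2 absorbs the drift term (1/2)^n. The exponent is \<gamma>/8 instead
    of \<gamma>/4 to allow for the rounding of \<open>\<gamma> * n / 4\<close>, which loses at most
    half once \<open>8 \<le> \<gamma> * n\<close>.\<close>
  define \<beta> where "\<beta> = max (1 / 2) (\<rho>' powr (\<gamma> / 8))"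
  have pow: "(\<rho>' powr (\<gamma> / 8)) ^ n = \<rho>' powr (\<gamma> * n / 8)" for n
    using \<rho>' by (simp add: powr_power mult.commute)
  have pow_le: "\<rho>' powr (\<gamma> * n / 8) \<le> \<beta> ^ n" for n
    unfolding pow[symmetric] by (intro power_mono) (auto simp: \<beta>_def)
  show thesis
  proof
    show "1 / 2 \<le> \<beta>" by (simp add: \<beta>_def)
    show "\<beta> < 1"
      using \<rho>' \<gamma> powr_less_mono2[of "\<gamma> / 8" \<rho>' 1] by (simp add: \<beta>_def)
    show "1 / 2 \<le> \<beta> ^ n" if "\<gamma> * real n < 8" for n
    proof -
      have "\<rho>' powr 1 \<le> \<rho>' powr (\<gamma> * n / 8)"
        using that \<rho>' by (intro powr_mono') auto
      with \<rho>' pow_le[of n] show ?thesis by simp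
    qed
    show "\<rho> ^ nat \<lfloor>\<gamma> * n / 4\<rfloor> \<le> \<beta> ^ n" if "8 \<le> \<gamma> * real n" for n
    proof -
      have "\<gamma> * n / 8 \<le> real (nat \<lfloor>\<gamma> * n / 4\<rfloor>)"
        using that by linarith
      then have "\<rho>' powr real (nat \<lfloor>\<gamma> * n / 4\<rfloor>) \<le> \<rho>' powr (\<gamma> * n / 8)"
        using \<rho>' by (intro powr_mono') auto
      then have "\<rho>' ^ nat \<lfloor>\<gamma> * n / 4\<rfloor> \<le> \<beta> ^ n"
        using \<rho>' pow_le[of n] by (simp add: powr_realpow)
      moreover have "\<rho> ^ nat \<lfloor>\<gamma> * n / 4\<rfloor> \<le> \<rho>' ^ nat \<lfloor>\<gamma> * n / 4\<rfloor>"
        using \<rho> \<rho>' by (intro power_mono) auto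
      ultimately show ?thesis by simp
    qed
  qed
qed

text \<open>The event of r_3 says nothing about time 0, so that factor is estimated by its worst
  value; hence the extra 2 in the exponent.\<close>

lemma prod_le_power_count:
  fixes t :: real and y :: "nat \<Rightarrow> 'y"
  assumes t: "1 \<le> t"
  shows "(\<Prod>i\<le>n. if y i \<in> K then 1 else ennreal (t\<^sup>2)) \<le>
    ennreal (t ^ (2 + 2 * card {i \<in> {1..n}. y i \<notin> K}))"
proof -
  let ?k = "\<lambda>i. if y i \<in> K then 1 else ennreal (t\<^sup>2)"
  have "(\<Prod>i\<in>{1..n}. ?k i) = (\<Prod>i\<in>{i \<in> {1..n}. y i \<notin> K}. ennreal (t\<^sup>2))"
    by (rule prod.mono_neutral_cong_right) auto
  also have "\<dots> = ennreal (t ^ (2 * card {i \<in> {1..n}. y i \<notin> K}))"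
    using t by (simp add: ennreal_power power_mult)
  finally have tail: "(\<Prod>i\<in>{1..n}. ?k i) = \<dots>" .
  have "{..n} = insert 0 {1..n}" by auto
  then have "(\<Prod>i\<le>n. ?k i) = ?k 0 * (\<Prod>i\<in>{1..n}. ?k i)"
    by simp
  also have "\<dots> \<le> ennreal (t\<^sup>2) * ennreal (t ^ (2 * card {i \<in> {1..n}. y i \<notin> K}))"
    unfolding tail using t by (intro mult_right_mono) (auto simp: ennreal_1[symmetric] simp del: ennreal_1)
  also have "\<dots> = ennreal (t ^ (2 + 2 * card {i \<in> {1..n}. y i \<notin> K}))"
    using t by (simp add: ennreal_mult[symmetric] power_add power2_eq_square)
  finally show ?thesis .
qed

lemma count_complement:
  fixes \<gamma> :: real
  assumes "\<not> inverse (real n) * (\<Sum>i=1..n. indicator K (y i)) \<le> (1 + \<gamma>) / 2" "1 \<le> n"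
  shows "2 * real (card {i \<in> {1..n}. y i \<notin> K}) \<le> (1 - \<gamma>) * n"
proof -
  have "real n = (\<Sum>i=1..n. 1)"
    by simp
  also have "\<dots> = (\<Sum>i=1..n. indicator K (y i) + (if y i \<notin> K then 1 else 0))"
    by (intro sum.cong) auto
  also have "\<dots> = (\<Sum>i=1..n. indicator K (y i)) + real (card {i \<in> {1..n}. y i \<notin> K})"
    by (simp add: sum.distrib flip: sum.inter_filter)
  finally have "real (card {i \<in> {1..n}. y i \<notin> K}) = real n - (\<Sum>i=1..n. indicator K (y i))"
    by simp
  moreover have "(1 + \<gamma>) / 2 * n < (\<Sum>i=1..n. indicator K (y i))"
    using assms by (simp add: field_simps)
  ultimately show ?thesis
    by (simp add: algebra_simps)
qed

section \<open>Forgetting of the initial distribution\<close>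

context lyapunov_model
begin

lemma V_integral_ge_1:
  assumes "prob_space nu" "sets nu = sets X"
  shows "1 \<le> (\<integral>\<^sup>+x. ennreal (V x) \<partial>nu)"
proof -
  interpret nu: prob_space nu by fact
  have "1 = (\<integral>\<^sup>+x. 1 \<partial>nu)" by (simp add: nu.emeasure_space_1)
  also have "\<dots> \<le> (\<integral>\<^sup>+x. ennreal (V x) \<partial>nu)"
    using assms(2) V_ge_1 by (intro nn_integral_mono) (auto dest: sets_eq_imp_space_eq)
  finally show ?thesis .
qed

lemma path_int_lower_exp:
  fixes lo :: real
  assumes nu: "sets nu = sets X" and LD: "LD_with X Q D lam lo up" and y: "\<And>i. y i \<in> space Y"
    and n: "1 \<le> n"
    and Phi: "ennreal (exp (- M0 * n)) \<le> Phi Q g nu D (y 0) (y 1)"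
    and Psi: "ennreal (exp (- M2 * n)) \<le> (\<Prod>i=2..n. Psi g lam D (y i))"
  shows "ennreal (exp (- M0 * n) * exp (- M2 * n) * min lo 1 ^ n) \<le> path_int Q g nu y n (\<lambda>_. 1)"
proof -
  have lo: "0 < lo" using LD by (simp add: LD_with_def)
  \<comment> \<open>Only \<open>n - 1\<close> Doeblin steps are made. A base of at most 1 allows the
    exponent \<open>n\<close>, so that the whole bound is an n-th power.\<close>
  have "min lo 1 ^ n \<le> min lo 1 ^ (n - 1)"
    using lo by (intro power_decreasing) auto
  also have "\<dots> \<le> lo ^ (n - 1)"
    using lo by (intro power_mono) auto
  finally have "ennreal (exp (- M0 * n) * exp (- M2 * n) * min lo 1 ^ n) \<le>
      ennreal (exp (- M0 * n) * exp (- M2 * n) * lo ^ (n - 1))"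
    by (intro ennreal_leI mult_left_mono) auto
  also have "\<dots> = ennreal (exp (- M0 * n)) * (ennreal lo ^ (n - 1) * ennreal (exp (- M2 * n)))"
    using lo by (simp add: ennreal_mult ennreal_power ac_simps)
  also have "\<dots> \<le> Phi Q g nu D (y 0) (y 1) * (ennreal lo ^ (n - 1) * (\<Prod>i=2..n. Psi g lam D (y i)))"
    by (intro mult_mono Phi Psi order_refl) auto
  also have "\<dots> = Phi Q g nu D (y 0) (y 1) * (\<Prod>i=2..n. ennreal lo * Psi g lam D (y i))"
    by (simp add: prod.distrib)
  also have "\<dots> \<le> path_int Q g nu y n (indicator D)"
    by (rule path_int_lower[OF nu LD y n])
  also have "\<dots> \<le> path_int Q g nu y n (\<lambda>_. 1)"
    using nu by (rule path_int_mono) (simp add: indicator_def)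
  finally show ?thesis .
qed

text \<open>The estimate for one observation path off all exceptional events. Relative to the
  product of the denominators, the first remainder of the pair contraction is at most \<rho>^s \<le>
  \<beta>^n, and the second at most (1/2)^n \<le> \<beta>^n times the product of the integrals of
  \<open>V\<close>; together they give the factor 1 plus that product.\<close>

lemma tv_dist_filt_path_bound:
  fixes lo M0 M1 M2 \<gamma> E t lo' up' \<beta> :: real
  assumes phi0: "sets phi0 = sets X"
    and nu: "prob_space nu" "sets nu = sets X" and nu': "prob_space nu'" "sets nu' = sets X"
    and y: "\<And>i. y i \<in> space Y"
    and LD: "LD_with X Q D lam lo up"
    and E: "E = exp (2 * (M0 + M1 + M2)) / (min lo 1)\<^sup>2" "1 \<le> E"
    and \<gamma>: "0 < \<gamma>" and t: "t = (2 * E) powr (2 / \<gamma>)"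
    and LDC: "LD_with X Q C lamC lo' up'"
    and C: "\<forall>y\<in>K. Upsilon Q g V (space X - C) y \<le> ennreal (1 / t\<^sup>2) * Upsilon Q g V (space X) y"
    and \<rho>: "\<rho> = 1 - (lo' / up')\<^sup>2" "0 \<le> \<rho>"
    and \<beta>: "1 / 2 \<le> \<beta>" "\<rho> ^ nat \<lfloor>\<gamma> * n / 4\<rfloor> \<le> \<beta> ^ n"
    and n: "8 \<le> \<gamma> * n"
    and Phi: "\<not> elog (Phi Q g nu D (y 0) (y 1)) \<le> ereal (- M0 * n)"
      "\<not> elog (Phi Q g nu' D (y 0) (y 1)) \<le> ereal (- M0 * n)"
    and Ups: "\<not> ereal (M1 * n) \<le> (\<Sum>i=0..n. elog (Upsilon Q g V (space X) (y i)))"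
    and Psi: "\<not> (\<Sum>i=2..n. elog (Psi g lam D (y i))) \<le> ereal (- M2 * n)"
    and K: "\<not> inverse (real n) * (\<Sum>i=1..n. indicator K (y i)) \<le> (1 + \<gamma>) / 2"
  shows "ennreal (tv_dist (filt X Q g phi0 nu n y) (filt X Q g phi0 nu' n y)) \<le>
    ennreal (\<beta> ^ n) * (1 + (\<integral>\<^sup>+x. ennreal (V x) \<partial>nu) * (\<integral>\<^sup>+x. ennreal (V x) \<partial>nu'))"
proof -
  define U where "U i = Upsilon Q g V (space X) (y i)" for i
  define W where "W = (\<integral>\<^sup>+x. ennreal (V x) \<partial>nu) * (\<integral>\<^sup>+x. ennreal (V x) \<partial>nu')"
  define s where "s = nat \<lfloor>\<gamma> * n / 4\<rfloor>"
  define m where "m = card {i \<in> {1..n}. y i \<notin> K}"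
  define a where "a nu = path_int Q g nu y n (\<lambda>_. 1)" for nu
  define A where "A = exp (- M0 * n) * exp (- M2 * n) * min lo 1 ^ n"
  have lo: "0 < lo" using LD by (simp add: LD_with_def)
  have n1: "1 \<le> n" using n by (cases n) auto
  have t1: "1 < t"
    unfolding t using \<gamma> E(2) by (intro gr_one_powr) auto
  have A: "0 < A" using lo by (simp add: A_def)
  show ?thesis
  proof (cases "W = \<infinity>")
    case True
    \<comment> \<open>If \<open>W\<close> is infinite, so is the right-hand side. Otherwise both
      integrals of \<open>V\<close> are finite, as neither is 0.\<close>
    have "0 < \<beta> ^ n" using \<beta>(1) by (intro zero_less_power) simp
    then have "ennreal (\<beta> ^ n) \<noteq> 0" by (metis ennreal_eq_0_iff not_le)
    then show ?thesis
      unfolding W_def[symmetric] True by (simp add: ennreal_mult_top)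
  next
    case False
    have U_fin: "U i \<noteq> \<infinity>" if "i \<le> n" for i
      using elog_sum_less_finite[OF _ Ups, of i] that by (simp add: U_def)
    then have "elog (\<Prod>i\<le>n. U i) = (\<Sum>i=0..n. elog (Upsilon Q g V (space X) (y i)))"
      unfolding atMost_atLeast0 by (subst elog_prod) (auto simp: U_def)
    with Ups have U_prod: "(\<Prod>i\<le>n. U i) \<le> ennreal (exp (M1 * n))"
      by (intro le_exp_of_elog) simp
    \<comment> \<open>Finiteness of the Upsilon factors, read off from the failure of the event of
      r_1, permits the logarithms of \<open>Psi\<close> to be combined into one.\<close>
    have "Psi g lam D (y i) \<noteq> \<infinity>" if "i \<in> {2..n}" for i
      using that U_fin[of i] by (intro Psi_finite[OF LD y]) (simp add: U_def)
    then have "elog (\<Prod>i=2..n. Psi g lam D (y i)) = (\<Sum>i=2..n. elog (Psi g lam D (y i)))"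
      by (rule elog_prod)
    with Psi have Psi_prod: "ennreal (exp (- M2 * n)) \<le> (\<Prod>i=2..n. Psi g lam D (y i))"
      by (intro exp_le_of_elog) simp
    have a_lower: "ennreal A \<le> a nu" "ennreal A \<le> a nu'"
      unfolding A_def a_def
      by (intro path_int_lower_exp[OF _ LD y n1] exp_le_of_elog Phi Psi_prod nu nu')+
    have VV: "(\<integral>\<^sup>+x. ennreal (V x) \<partial>nu) \<noteq> \<infinity>" "(\<integral>\<^sup>+x. ennreal (V x) \<partial>nu') \<noteq> \<infinity>"
      using False V_integral_ge_1[OF nu] V_integral_ge_1[OF nu']
      by (auto simp: W_def ennreal_mult_eq_top_iff)
    have a_fin: "a mu \<noteq> \<infinity>" if "sets mu = sets X" "(\<integral>\<^sup>+x. ennreal (V x) \<partial>mu) \<noteq> \<infinity>" for mu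
    proof -
      have "a mu \<le> ennreal (exp (M1 * n)) * (\<integral>\<^sup>+x. ennreal (V x) \<partial>mu)"
        unfolding a_def using U_prod
        by (intro order_trans[OF path_int_upper[OF that(1)] mult_right_mono]) (simp_all add: U_def)
      also have "\<dots> < \<infinity>"
        using that(2) by (simp add: ennreal_mult_less_top less_top)
      finally show ?thesis by simp
    qed
    define P where "P = (\<Prod>i\<le>n. (U i)\<^sup>2 * (if y i \<in> K then 1 else ennreal (t\<^sup>2)))"
    have "P = (\<Prod>i\<le>n. U i)\<^sup>2 * (\<Prod>i\<le>n. if y i \<in> K then 1 else ennreal (t\<^sup>2))"
      unfolding P_def by (simp add: prod.distrib prod_power_distrib)
    also have "\<dots> \<le> (ennreal (exp (M1 * n)))\<^sup>2 * ennreal (t ^ (2 + 2 * m))"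
      unfolding m_def using t1 by (intro mult_mono power_mono prod_le_power_count U_prod) auto
    also have "\<dots> = ennreal ((exp (M1 * n))\<^sup>2 * t ^ (2 + 2 * m))"
      using t1 by (simp add: ennreal_mult ennreal_power)
    finally have P_le: "P \<le> ennreal ((exp (M1 * n))\<^sup>2 * t ^ (2 + 2 * m))" .
    have balance: "(1 / t) ^ n * t ^ s * t ^ (2 + 2 * m) * E ^ n \<le> (1 / 2) ^ n"
    proof (rule exponent_balance[OF \<gamma> E(2) t])
      show "real s \<le> \<gamma> * n / 4" "2 \<le> \<gamma> * n / 4"
        unfolding s_def using n by linarith+
      show "2 * real m \<le> (1 - \<gamma>) * n"
        unfolding m_def using K n1 by (rule count_complement)
    qed
    \<comment> \<open>\<open>E\<close> is defined for this identity: the squared bound on the drift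
      product over the squared lower bound \<open>A\<close> of the denominators.\<close>
    have E_n: "E ^ n = (exp (M1 * n))\<^sup>2 / A\<^sup>2"
      unfolding E(1) A_def
      by (simp add: power_divide exp_of_nat_mult[symmetric] power_mult[symmetric] power_mult_distrib
          exp_minus exp_add[symmetric] field_simps mult_exp_exp)
    have "(1 / t) ^ n * t ^ s * ((exp (M1 * n))\<^sup>2 * t ^ (2 + 2 * m)) =
        (1 / t) ^ n * t ^ s * t ^ (2 + 2 * m) * E ^ n * A\<^sup>2"
      unfolding E_n using A by simp
    also have "\<dots> \<le> (1 / 2) ^ n * A\<^sup>2"
      using balance by (rule mult_right_mono) simp
    also have "\<dots> \<le> \<beta> ^ n * A\<^sup>2"
      using \<beta>(1) by (intro mult_right_mono power_mono) auto
    finally have rate: "ennreal ((1 / t) ^ n * t ^ s * ((exp (M1 * n))\<^sup>2 * t ^ (2 + 2 * m))) \<le> ennreal (\<beta> ^ n * A\<^sup>2)"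
      by (rule ennreal_leI)
    have "ennreal (1 / t) ^ n * ennreal t ^ s * P \<le>
        ennreal (1 / t) ^ n * ennreal t ^ s * ennreal ((exp (M1 * n))\<^sup>2 * t ^ (2 + 2 * m))"
      by (intro mult_left_mono P_le) simp
    also have "\<dots> = ennreal ((1 / t) ^ n * t ^ s * ((exp (M1 * n))\<^sup>2 * t ^ (2 + 2 * m)))"
      using t1 by (simp add: ennreal_mult ennreal_power)
    also note rate
    also have "ennreal (\<beta> ^ n * A\<^sup>2) = ennreal (\<beta> ^ n) * (ennreal A * ennreal A)"
      using \<beta>(1) A by (simp add: ennreal_mult power2_eq_square)
    also have "\<dots> \<le> ennreal (\<beta> ^ n) * (a nu * a nu')"
      by (intro mult_left_mono mult_mono a_lower) auto
    finally have "W * (ennreal (1 / t) ^ n * ennreal t ^ s * P) \<le> W * (ennreal (\<beta> ^ n) * (a nu * a nu'))"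
      by (rule mult_left_mono) simp
    then have second: "ennreal (1 / t) ^ n * ennreal t ^ s * (W * P) \<le> ennreal (\<beta> ^ n) * W * (a nu * a nu')"
      by (simp add: ac_simps)
    have first: "ennreal \<rho> ^ s * (a nu * a nu') \<le> ennreal (\<beta> ^ n) * (a nu * a nu')"
      using \<beta>(2) \<rho>(2) by (intro mult_right_mono) (auto simp: s_def ennreal_power ennreal_leI)
    have remainder: "ennreal \<rho> ^ s * (a nu * a nu') + ennreal (1 / t) ^ n * ennreal t ^ s * (W * P) \<le>
        ennreal (\<beta> ^ n) * (1 + W) * (a nu * a nu')"
      using add_mono[OF first second] by (simp add: distrib_left distrib_right)
    show ?thesis
      unfolding W_def[symmetric]
    proof (rule tv_dist_filt_le[OF phi0 nu(2) _ nu'(2) _ y])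
      show "path_int Q g nu y n (\<lambda>_. 1) \<notin> {0, \<infinity>}" "path_int Q g nu' y n (\<lambda>_. 1) \<notin> {0, \<infinity>}"
        using a_lower A a_fin[OF nu(2) VV(1)] a_fin[OF nu'(2) VV(2)] by (auto simp: a_def)
    next
      fix B assume B: "B \<in> sets X"
      have "path_int Q g nu y n (indicator B) * a nu' \<le> a nu * path_int Q g nu' y n (indicator B) +
          (ennreal \<rho> ^ s * (a nu * a nu') + ennreal (1 / t) ^ n * ennreal t ^ s * (W * P))"
        unfolding a_def W_def P_def U_def
        by (rule path_int_pair_contraction[OF nu nu' LDC C t1 \<rho> _ _ y])
          (use B in \<open>auto simp: indicator_def\<close>)
      also have "\<dots> \<le> a nu * path_int Q g nu' y n (indicator B) + ennreal (\<beta> ^ n) * (1 + W) * (a nu * a nu')"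
        by (intro add_left_mono remainder)
      finally show "path_int Q g nu y n (indicator B) * path_int Q g nu' y n (\<lambda>_. 1) \<le>
          path_int Q g nu y n (\<lambda>_. 1) * path_int Q g nu' y n (indicator B) +
          ennreal (\<beta> ^ n) * (1 + W) * (path_int Q g nu y n (\<lambda>_. 1) * path_int Q g nu' y n (\<lambda>_. 1))"
        unfolding a_def .
      have "path_int Q g nu' y n (indicator B) * a nu \<le> a nu' * path_int Q g nu y n (indicator B) +
          (ennreal \<rho> ^ s * (a nu' * a nu) + ennreal (1 / t) ^ n * ennreal t ^ s *
            ((\<integral>\<^sup>+x. ennreal (V x) \<partial>nu') * (\<integral>\<^sup>+x. ennreal (V x) \<partial>nu) * P))"
        unfolding a_def W_def P_def U_def
        by (rule path_int_pair_contraction[OF nu' nu LDC C t1 \<rho> _ _ y])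
          (use B in \<open>auto simp: indicator_def\<close>)
      also have "\<dots> = a nu' * path_int Q g nu y n (indicator B) +
          (ennreal \<rho> ^ s * (a nu * a nu') + ennreal (1 / t) ^ n * ennreal t ^ s * (W * P))"
        unfolding W_def by (simp add: ac_simps)
      also have "\<dots> \<le> a nu' * path_int Q g nu y n (indicator B) + ennreal (\<beta> ^ n) * (1 + W) * (a nu * a nu')"
        by (intro add_left_mono remainder)
      finally show "path_int Q g nu' y n (indicator B) * path_int Q g nu y n (\<lambda>_. 1) \<le>
          path_int Q g nu' y n (\<lambda>_. 1) * path_int Q g nu y n (indicator B) +
          ennreal (\<beta> ^ n) * (1 + W) * (path_int Q g nu y n (\<lambda>_. 1) * path_int Q g nu' y n (\<lambda>_. 1))"
        unfolding a_def .
    qed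
  qed
qed

end

text \<open>\<open>C\<close> has a point because \<open>lam\<close> charges it; the two Doeblin
  bounds are compared there. This places \<rho> in the interval from 0 (included) to 1
  (excluded).\<close>

lemma LD_with_ratio_le_1:
  assumes LD: "LD_with X Q C lam lo up" and Q: "Q \<in> X \<rightarrow>\<^sub>M prob_algebra X"
  shows "0 < lo / up" "lo / up \<le> 1"
proof -
  have C: "C \<in> sets X" "0 < emeasure lam C" and pos: "0 < lo" "0 < up"
    using LD by (auto simp: LD_with_def)
  then obtain x where x: "x \<in> C" by fastforce
  have "ennreal lo * emeasure lam C \<le> emeasure (Q x) C" "emeasure (Q x) C \<le> ennreal up * emeasure lam C"
    using LD x C by (force simp: LD_with_def)+
  moreover have "emeasure (Q x) C \<le> 1"
  proof -
    have "x \<in> space X" using x C(1) sets.sets_into_space by auto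
    then interpret prob_space "Q x"
      using measurable_space[OF Q] by (auto simp: space_prob_algebra)
    show ?thesis by (rule emeasure_le_1)
  qed
  ultimately have "lo \<le> up"
    using doeblin_constants(2) C(2) pos by blast
  with pos show "0 < lo / up" "lo / up \<le> 1" by simp_all
qed

theorem theorem3:
  fixes X :: "'x measure" and Y :: "'y measure"
    and Q :: "'x \<Rightarrow> 'x measure" and G :: "'x \<Rightarrow> 'y measure" and mu :: "'y measure"
    and g :: "'x \<Rightarrow> 'y \<Rightarrow> real"
    and P :: "'w measure" and Yp :: "nat \<Rightarrow> 'w \<Rightarrow> 'y"
    and phi0 :: "'x measure"
    and K :: "'y set" and V :: "'x \<Rightarrow> real"
    and D :: "'x set" and lamD :: "'x measure" and eD_lo eD_up :: real
    and M0 M1 M2 \<gamma> :: real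
  assumes "countably_generated X" and "countably_generated Y"
    and "Q \<in> X \<rightarrow>\<^sub>M prob_algebra X"
    and "transition_kernel X Y G"
    and "sets mu = sets Y"
    and "\<forall>x\<in>space X. absolutely_continuous mu (G x)"
    and "\<forall>x\<in>space X. \<forall>y\<in>space Y. 0 \<le> g x y"
    and "(\<lambda>(x, y). g x y) \<in> borel_measurable (X \<Otimes>\<^sub>M Y)"
    and "\<forall>x\<in>space X. G x = density mu (\<lambda>y. ennreal (g x y))"
    and "prob_space phi0" and "sets phi0 = sets X"
    and "prob_space P"
    and "\<forall>k. Yp k \<in> P \<rightarrow>\<^sub>M Y"
    and "K \<subseteq> space Y"
    and "V \<in> borel_measurable X" and "\<forall>x\<in>space X. 1 \<le> V x"
    and "\<forall>\<eta>::real. 0 < \<eta> \<longrightarrow>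
           (\<exists>C. LD_set X Q C \<and>
             (\<forall>y\<in>K. Upsilon Q g V (space X - C) y \<le> ennreal \<eta> * Upsilon Q g V (space X) y))"
    and "LD_with X Q D lamD eD_lo eD_up"
    and "0 < M0" and "0 < M1" and "0 < M2" and "0 < \<gamma>" and "\<gamma> < 1"
  shows "\<exists>\<beta>::real. 0 < \<beta> \<and> \<beta> < 1 \<and>
    (\<forall>nu nu' n.
       prob_space nu \<and> sets nu = sets X \<and> prob_space nu' \<and> sets nu' = sets X \<longrightarrow>
       (\<integral>\<^sup>+w. ennreal (tv_dist (filt X Q g phi0 nu n (\<lambda>i. Yp i w))
                           (filt X Q g phi0 nu' n (\<lambda>i. Yp i w))) \<partial>P)
       \<le> ennreal (\<beta> ^ n) * (1 + (\<integral>\<^sup>+x. ennreal (V x) \<partial>nu) * (\<integral>\<^sup>+x. ennreal (V x) \<partial>nu'))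
         + event_prob P (\<lambda>w. elog (Phi Q g nu D (Yp 0 w) (Yp 1 w)) \<le> ereal (- M0 * real n))
         + event_prob P (\<lambda>w. elog (Phi Q g nu' D (Yp 0 w) (Yp 1 w)) \<le> ereal (- M0 * real n))
         + event_prob P (\<lambda>w. (\<Sum>i=0..n. elog (Upsilon Q g V (space X) (Yp i w))) \<ge> ereal (M1 * real n))
         + event_prob P (\<lambda>w. (\<Sum>i=2..n. elog (Psi g lamD D (Yp i w))) \<le> ereal (- M2 * real n))
         + event_prob P (\<lambda>w. inverse (real n) * (\<Sum>i=1..n. indicator K (Yp i w)) \<le> (1 + \<gamma>) / 2))"
proof -
  note \<gamma> = \<open>0 < \<gamma>\<close> and LD = \<open>LD_with X Q D lamD eD_lo eD_up\<close>
  interpret lyapunov_model X Y Q g V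
    using assms by unfold_locales auto
  have lo: "0 < min eD_lo 1" using LD by (simp add: LD_with_def)
  \<comment> \<open>All constants chosen from here to \<beta> are fixed before \<open>nu\<close>,
    \<open>nu'\<close> and \<open>n\<close> are introduced.\<close>
  define E where "E = exp (2 * (M0 + M1 + M2)) / (min eD_lo 1)\<^sup>2"
  have "(min eD_lo 1)\<^sup>2 \<le> 1" using lo by (intro power_le_one) auto
  also have "1 \<le> exp (2 * (M0 + M1 + M2))"
    using \<open>0 < M0\<close> \<open>0 < M1\<close> \<open>0 < M2\<close> by simp
  finally have E: "1 \<le> E"
    unfolding E_def using lo by (subst le_divide_eq_1_pos) auto
  define t where "t = (2 * E) powr (2 / \<gamma>)"
  have "0 < t" using E by (simp add: t_def)
  then have "0 < 1 / t\<^sup>2" by simp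
  then obtain C lamC lo' up' where LDC: "LD_with X Q C lamC lo' up'"
    and C: "\<forall>y\<in>K. Upsilon Q g V (space X - C) y \<le> ennreal (1 / t\<^sup>2) * Upsilon Q g V (space X) y"
    using assms(17) unfolding LD_set_def by blast
  define \<rho> where "\<rho> = 1 - (lo' / up')\<^sup>2"
  have \<rho>: "0 \<le> \<rho>" "\<rho> < 1"
    using LD_with_ratio_le_1[OF LDC assms(3)] zero_less_power[of "lo' / up'" 2]
      power_le_one[of "lo' / up'" 2]
    by (auto simp: \<rho>_def simp del: zero_less_divide_iff zero_less_power2)
  \<comment> \<open>For $\gamma n < 8$ the bound is trivial because $\beta^n (1 + \nu(V)\nu'(V)) \ge 2\beta^n \ge 1$.\<close>
  obtain \<beta> :: real where \<beta>: "1 / 2 \<le> \<beta>" "\<beta> < 1"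
    and small: "\<And>n. \<gamma> * real n < 8 \<Longrightarrow> 1 / 2 \<le> \<beta> ^ n"
    and large: "\<And>n. 8 \<le> \<gamma> * real n \<Longrightarrow> \<rho> ^ nat \<lfloor>\<gamma> * n / 4\<rfloor> \<le> \<beta> ^ n"
    using geometric_rate[OF \<gamma> \<rho>] by metis
  have y: "Yp i w \<in> space Y" if "w \<in> space P" for i w
    using assms(13) that by (auto dest: measurable_space)
  show ?thesis
  proof (intro exI[of _ \<beta>] conjI allI impI)
    show "0 < \<beta>" "\<beta> < 1" using \<beta> by auto
    fix nu nu' :: "'x measure" and n :: nat
    assume "prob_space nu \<and> sets nu = sets X \<and> prob_space nu' \<and> sets nu' = sets X"
    then have nu: "prob_space nu" "sets nu = sets X" and nu': "prob_space nu'" "sets nu' = sets X"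
      by auto
    define c where "c = ennreal (\<beta> ^ n) * (1 + (\<integral>\<^sup>+x. ennreal (V x) \<partial>nu) * (\<integral>\<^sup>+x. ennreal (V x) \<partial>nu'))"
    define R1 where "R1 w \<longleftrightarrow> elog (Phi Q g nu D (Yp 0 w) (Yp 1 w)) \<le> ereal (- M0 * real n)" for w
    define R2 where "R2 w \<longleftrightarrow> elog (Phi Q g nu' D (Yp 0 w) (Yp 1 w)) \<le> ereal (- M0 * real n)" for w
    define R3 where "R3 w \<longleftrightarrow> (\<Sum>i=0..n. elog (Upsilon Q g V (space X) (Yp i w))) \<ge> ereal (M1 * real n)" for w
    define R4 where "R4 w \<longleftrightarrow> (\<Sum>i=2..n. elog (Psi g lamD D (Yp i w))) \<le> ereal (- M2 * real n)" for w
    define R5 where "R5 w \<longleftrightarrow> inverse (real n) * (\<Sum>i=1..n. indicator K (Yp i w)) \<le> (1 + \<gamma>) / 2" for w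
    let ?tv = "\<lambda>w. ennreal (tv_dist (filt X Q g phi0 nu n (\<lambda>i. Yp i w)) (filt X Q g phi0 nu' n (\<lambda>i. Yp i w)))"
    have tv1: "?tv w \<le> 1" if "w \<in> space P" for w
      using assms(10,11) nu nu' y[OF that] by (intro tv_dist_filt_le_1)
    have "(\<integral>\<^sup>+w. ?tv w \<partial>P) \<le> c + event_prob P (\<lambda>w. (((R1 w \<or> R2 w) \<or> R3 w) \<or> R4 w) \<or> R5 w)"
    proof (rule nn_integral_le_event_prob[OF assms(12) tv1])
      fix w assume w: "w \<in> space P" and good: "\<not> ((((R1 w \<or> R2 w) \<or> R3 w) \<or> R4 w) \<or> R5 w)"
      show "?tv w \<le> c"
      proof (cases "\<gamma> * real n < 8")
        case True
        have "?tv w \<le> 1" using w by (rule tv1)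
        also have "1 = ennreal (1 / 2 * 2)"
          by simp
        also have "\<dots> = ennreal (1 / 2) * (1 + 1 * 1)"
          by (subst ennreal_mult) auto
        also have "\<dots> \<le> c"
          unfolding c_def using small[OF True]
          by (intro mult_mono add_left_mono V_integral_ge_1 nu nu' ennreal_leI) auto
        finally show ?thesis .
      next
        case False
        then have n: "8 \<le> \<gamma> * real n" by simp
        show ?thesis
          unfolding c_def using good
          by (intro tv_dist_filt_path_bound[OF assms(11) nu nu' y[OF w] LD E_def E \<gamma> t_def LDC C
                \<rho>_def \<rho>(1) \<beta>(1) large[OF n] n])
             (auto simp: R1_def R2_def R3_def R4_def R5_def)
      qed
    qed
    \<comment> \<open>Subadditivity is applied four times; the disjunction is nested to the left so
      that it unfolds into the sum in the same order.\<close>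
    also have "\<dots> \<le> c + ((((event_prob P R1 + event_prob P R2) + event_prob P R3) + event_prob P R4) + event_prob P R5)"
      by (intro add_left_mono order_trans[OF event_prob_disj_le] add_right_mono order_refl)
    finally show "(\<integral>\<^sup>+w. ?tv w \<partial>P)
       \<le> ennreal (\<beta> ^ n) * (1 + (\<integral>\<^sup>+x. ennreal (V x) \<partial>nu) * (\<integral>\<^sup>+x. ennreal (V x) \<partial>nu'))
         + event_prob P (\<lambda>w. elog (Phi Q g nu D (Yp 0 w) (Yp 1 w)) \<le> ereal (- M0 * real n))
         + event_prob P (\<lambda>w. elog (Phi Q g nu' D (Yp 0 w) (Yp 1 w)) \<le> ereal (- M0 * real n))
         + event_prob P (\<lambda>w. (\<Sum>i=0..n. elog (Upsilon Q g V (space X) (Yp i w))) \<ge> ereal (M1 * real n))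
         + event_prob P (\<lambda>w. (\<Sum>i=2..n. elog (Psi g lamD D (Yp i w))) \<le> ereal (- M2 * real n))
         + event_prob P (\<lambda>w. inverse (real n) * (\<Sum>i=1..n. indicator K (Yp i w)) \<le> (1 + \<gamma>) / 2)"
      unfolding c_def R1_def R2_def R3_def R4_def R5_def by (simp only: add.assoc)
  qed
qed

end
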